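(* Let $K$ be a field of characteristic zero and let $d$ be a non-negative integer. Let $A$ and $B$ be standard graded artinian Gorenstein $K$-algebras, both of codimension two and both of socle degree $d$, and let $\ell\in A_1$ and $\ell'\in B_1$ be linear forms. If the Jordan types are equal, $P_{\ell,A}=P_{\ell',B}$, then the Jordan degree types are equal, $\mathcal{S}_{\ell,A}=\mathcal{S}_{\ell',B}$. In other words, if a partition $P=(P_1,\dots,P_t)$ is the Jordan type of some artinian Gorenstein algebra of codimension two and socle degree $d$ and a linear form, then the Jordan degree type associated to $P$ is uniquely determined.
   Context: Let $K$ be a field of characteristic zero. A standard graded artinian $K$-algebra is a quotient $A=S/I$, where $S=K[x_1,\dots,x_n]$ has the standard grading, $I\subset S$ is a homogeneous ideal, and $A$ has Krull dimension zero (equivalently $\dim_K A<\infty$). Write $A_i$ for the degree-$i$ component and $h_A(i)=\dim_K A_i$ for the Hilbert function. The socle degree of $A$ is the largest $i$ with $h_A(i)>0$. The codimension of $A$ is $h_A(1)$; so codimension two means that $A\cong K[x,y]/I$ with $I$ homogeneous and containing no nonzero linear form or constant. The algebra $A$ of socle degree $d$ is Gorenstein if and only if there is a form $F$ of degree $d$ in the dual polynomial ring $R=K[X_1,\dots,X_n]$ such that $I=\mathrm{Ann}_S(F)=\{g\in S: g\circ F=0\}$, where $S$ acts on $R$ by differentiation ($x_i$ acts as $\partial/\partial X_i$). Jordan type: for $\ell\in A_1$, multiplication by $\ell$ is a nilpotent $K$-linear endomorphism of $A$. The Jordan type $P_{\ell,A}=(p_1,\dots,p_t)$ is the partition of $\dim_K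 A$ (parts listed in non-increasing order) given by the sizes of the Jordan blocks of this map. Jordan degree type: with $P_{\ell,A}=(p_1,\dots,p_t)$, there exist homogeneous elements $z_1,\dots,z_t\in A$ (depending on $\ell$) such that $\{\ell^i z_k : 1\le k\le t,\ 0\le i\le p_k-1\}$ is a $K$-basis of $A$ and $A$ is the direct sum of the spans of the strings $\{z_k,\ell z_k,\dots,\ell^{p_k-1}z_k\}$, each of which spans a Jordan block of multiplication by $\ell$ (so $\ell^{p_k}z_k=0$). Let $d_k=\deg z_k$. The Jordan degree type $\mathcal{S}_{\ell,A}=((p_1)_{d_1},\dots,(p_t)_{d_t})$ is the indexed partition recording the multiset of pairs $(p_k,d_k)$; it does not depend on the choice of the $z_k$. Equivalently, the number of pairs $(p,e)$ with $p=j-i+1$ and $e=i$ (for $0\le i\le j\le d$) equals $r_{i,j}+r_{i-1,j+1}-r_{i-1,j}-r_{i,j+1}$, where $r_{i,j}$ is the rank of $\ell^{j-i}:A_i\to A_j$ for $0\le i\le j\le d$, and $r_{i,j}=0$ if $i<0$ or $j>d$. *)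

theory Defs
  imports
    "HOL-Library.Poly_Mapping"
    "HOL-Library.Multiset"
    "HOL-Algebra.QuotRing"
    "HOL-Algebra.Embedded_Algebras"
begin

section \<open>The polynomial ring and its grading\<close>

text \<open>
  The variables are indexed by an arbitrary finite type, so a free type variable \<open>'n\<close> stands
  for an arbitrary positive number of variables. The same type also serves as the dual
  polynomial ring on which the polynomials act by differentiation.
\<close>

type_synonym ('n, 'k) mpoly = "('n \<Rightarrow>\<^sub>0 nat) \<Rightarrow>\<^sub>0 'k"

definition poly_ring :: "('n::finite, 'k::field_char_0) mpoly ring" where
  "poly_ring = \<lparr>carrier = UNIV, mult = (*), one = 1, zero = 0, add = (+)\<rparr>"

lemma poly_ring_simps [simp]:
  "carrier poly_ring = UNIV"
  "f \<otimes>\<^bsub>poly_ring\<^esub> g = f * g"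
  "f \<oplus>\<^bsub>poly_ring\<^esub> g = f + g"
  "\<one>\<^bsub>poly_ring\<^esub> = 1"
  "\<zero>\<^bsub>poly_ring\<^esub> = 0"
  by (simp_all add: poly_ring_def)

lemma cring_poly_ring: "cring (poly_ring :: ('n::finite, 'k::field_char_0) mpoly ring)"
proof (rule cringI)
  have "\<exists>g. g + f = 0" for f :: "('n, 'k) mpoly"
    by (rule exI[of _ "- f"]) simp
  then show "abelian_group (poly_ring :: ('n, 'k) mpoly ring)"
    by (intro abelian_groupI) (auto simp: ac_simps)
  show "Group.comm_monoid (poly_ring :: ('n, 'k) mpoly ring)"
    by (intro comm_monoidI) (auto simp: ac_simps)
qed (auto simp: algebra_simps)

definition const_poly :: "'k::field_char_0 \<Rightarrow> ('n::finite, 'k) mpoly" where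
  "const_poly c = Poly_Mapping.single 0 c"

definition monom_deg :: "('n::finite \<Rightarrow>\<^sub>0 nat) \<Rightarrow> nat" where
  "monom_deg m = (\<Sum>i\<in>UNIV. Poly_Mapping.lookup m i)"

definition forms :: "nat \<Rightarrow> ('n::finite, 'k::field_char_0) mpoly set" where
  "forms i = {f. \<forall>m\<in>Poly_Mapping.keys f. monom_deg m = i}"

definition hom_part :: "nat \<Rightarrow> ('n::finite, 'k::field_char_0) mpoly \<Rightarrow> ('n, 'k) mpoly" where
  "hom_part i f =
     (\<Sum>m\<in>{m \<in> Poly_Mapping.keys f. monom_deg m = i}.
        Poly_Mapping.single m (Poly_Mapping.lookup f m))"

definition homogeneous_ideal :: "('n::finite, 'k::field_char_0) mpoly set \<Rightarrow> bool" where
  "homogeneous_ideal I \<longleftrightarrow> ideal I poly_ring \<and> (\<forall>f\<in>I. \<forall>i. hom_part i f \<in> I)"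


section \<open>Graded quotient algebras\<close>

abbreviation quot_alg :: "('n::finite, 'k::field_char_0) mpoly set \<Rightarrow> ('n, 'k) mpoly set ring" where
  "quot_alg I \<equiv> poly_ring Quot I"

text \<open>
  The copy of the ground field inside the quotient; dimensions and linear independence in the
  quotient are taken over this subfield.
\<close>

definition scalars :: "('n::finite, 'k::field_char_0) mpoly set \<Rightarrow> ('n, 'k) mpoly set set" where
  "scalars I = (\<lambda>c. I +>\<^bsub>poly_ring\<^esub> const_poly c) ` UNIV"

definition graded_piece ::
  "('n::finite, 'k::field_char_0) mpoly set \<Rightarrow> nat \<Rightarrow> ('n, 'k) mpoly set set" where
  "graded_piece I i = (\<lambda>f. I +>\<^bsub>poly_ring\<^esub> f) ` forms i"

definition standard_graded_artinian :: "('n::finite, 'k::field_char_0) mpoly set \<Rightarrow> bool" where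
  "standard_graded_artinian I \<longleftrightarrow>
     homogeneous_ideal I \<and>
     ring.finite_dimension (quot_alg I) (scalars I) (carrier (quot_alg I))"

definition hilbert_fun :: "('n::finite, 'k::field_char_0) mpoly set \<Rightarrow> nat \<Rightarrow> nat" where
  "hilbert_fun I i = ring.dim (quot_alg I) (scalars I) (graded_piece I i)"

definition socle_degree :: "('n::finite, 'k::field_char_0) mpoly set \<Rightarrow> nat" where
  "socle_degree I = (GREATEST i. hilbert_fun I i > 0)"

definition codimension :: "('n::finite, 'k::field_char_0) mpoly set \<Rightarrow> nat" where
  "codimension I = hilbert_fun I 1"


section \<open>Action by differentiation and Gorenstein algebras\<close>

text \<open>
  The monomial with exponent \<open>m\<close> sends the monomial with exponent \<open>u\<close> to the monomial with
  exponent \<open>u - m\<close>, times the product over all variables \<open>i\<close> of the falling factorial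
  \<open>u\<^sub>i (u\<^sub>i - 1) \<dots> (u\<^sub>i - m\<^sub>i + 1)\<close>. If \<open>m\<^sub>i > u\<^sub>i\<close> for some \<open>i\<close> this product has a zero factor, so
  the truncation in \<open>u - m\<close> is harmless.
\<close>

definition diff_coeff :: "('n::finite \<Rightarrow>\<^sub>0 nat) \<Rightarrow> ('n \<Rightarrow>\<^sub>0 nat) \<Rightarrow> 'k::field_char_0" where
  "diff_coeff m u =
     (\<Prod>i\<in>UNIV. \<Prod>j<Poly_Mapping.lookup m i. of_nat (Poly_Mapping.lookup u i) - of_nat j)"

definition diff_act ::
  "('n::finite, 'k::field_char_0) mpoly \<Rightarrow> ('n, 'k) mpoly \<Rightarrow> ('n, 'k) mpoly" where
  "diff_act g F =
     (\<Sum>m\<in>Poly_Mapping.keys g. \<Sum>u\<in>Poly_Mapping.keys F.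
        Poly_Mapping.single (u - m)
          (Poly_Mapping.lookup g m * Poly_Mapping.lookup F u * diff_coeff m u))"

lemma diff_act_variable:
  fixes F :: "('n::finite, 'k::field_char_0) mpoly"
  shows "diff_act (Poly_Mapping.single (Poly_Mapping.single i 1) 1) F =
    (\<Sum>u\<in>Poly_Mapping.keys F.
       Poly_Mapping.single (u - Poly_Mapping.single i 1)
         (of_nat (Poly_Mapping.lookup u i) * Poly_Mapping.lookup F u))"
proof -
  have "diff_coeff (Poly_Mapping.single i 1) u = (of_nat (Poly_Mapping.lookup u i) :: 'k)"
    for u :: "'n \<Rightarrow>\<^sub>0 nat"
  proof -
    have "diff_coeff (Poly_Mapping.single i 1) u =
        (\<Prod>j\<in>UNIV. if j = i then of_nat (Poly_Mapping.lookup u i) else (1 :: 'k))"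
      unfolding diff_coeff_def by (intro prod.cong) (auto simp: lookup_single)
    then show ?thesis by simp
  qed
  then show ?thesis by (simp add: diff_act_def mult.commute)
qed

definition annihilator :: "('n::finite, 'k::field_char_0) mpoly \<Rightarrow> ('n, 'k) mpoly set" where
  "annihilator F = {g. diff_act g F = 0}"

definition gorenstein :: "('n::finite, 'k::field_char_0) mpoly set \<Rightarrow> bool" where
  "gorenstein I \<longleftrightarrow> (\<exists>F\<in>forms (socle_degree I). I = annihilator F)"


section \<open>Jordan type and Jordan degree type\<close>

text \<open>
  A Jordan string is given by its generator \<open>z\<close> and its length \<open>p\<close>. A decomposition is a list of
  strings whose concatenation is a basis of the quotient; independence of a list includes
  distinctness of its entries, so the quotient is the direct sum of the spans of the strings.
\<close>

definition jordan_string ::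
  "('n::finite, 'k::field_char_0) mpoly set \<Rightarrow> ('n, 'k) mpoly set \<Rightarrow>
   ('n, 'k) mpoly set \<Rightarrow> nat \<Rightarrow> ('n, 'k) mpoly set list" where
  "jordan_string I l z p =
     map (\<lambda>i. (l [^]\<^bsub>quot_alg I\<^esub> i) \<otimes>\<^bsub>quot_alg I\<^esub> z) [0..<p]"

definition jordan_decomposition ::
  "('n::finite, 'k::field_char_0) mpoly set \<Rightarrow> ('n, 'k) mpoly set \<Rightarrow>
   (('n, 'k) mpoly set \<times> nat) list \<Rightarrow> bool" where
  "jordan_decomposition I l zps \<longleftrightarrow>
     (\<forall>(z, p) \<in> set zps. z \<in> carrier (quot_alg I) \<and> p > 0 \<and>
        (l [^]\<^bsub>quot_alg I\<^esub> p) \<otimes>\<^bsub>quot_alg I\<^esub> z = \<zero>\<^bsub>quot_alg I\<^esub>) \<and>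
     (let bs = concat (map (\<lambda>(z, p). jordan_string I l z p) zps)
      in ring.independent (quot_alg I) (scalars I) bs \<and>
         ring.Span (quot_alg I) (scalars I) bs = carrier (quot_alg I))"

text \<open>Partitions are represented by the multisets of their parts.\<close>

definition is_jordan_type ::
  "('n::finite, 'k::field_char_0) mpoly set \<Rightarrow> ('n, 'k) mpoly set \<Rightarrow> nat multiset \<Rightarrow> bool" where
  "is_jordan_type I l P \<longleftrightarrow>
     (\<exists>zps. jordan_decomposition I l zps \<and> P = mset (map snd zps))"

text \<open>
  In a pair \<open>(p, e)\<close> of a Jordan degree type, \<open>p\<close> is the length of a string and \<open>e\<close> is the degree
  of its homogeneous generator; the generator is nonzero, so \<open>e\<close> is determined by it.
\<close>

definition is_jordan_degree_type ::
  "('n::finite, 'k::field_char_0) mpoly set \<Rightarrow> ('n, 'k) mpoly set \<Rightarrow> (nat \<times> nat) multiset \<Rightarrow> bool" where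
  "is_jordan_degree_type I l T \<longleftrightarrow>
     (\<exists>zps es. jordan_decomposition I l zps \<and>
        list_all2 (\<lambda>(z, p) e. z \<in> graded_piece I e) zps es \<and>
        T = mset (zip (map snd zps) es))"

end

theory Submission
  imports Defs
begin

text \<open>
  Let \<open>A\<close> be the quotient by \<open>I\<close> and let \<open>L\<close> be a linear form representing \<open>\<ell>\<close>.

  If \<open>\<ell> \<noteq> 0\<close>, codimension two gives a second linear form \<open>M\<close> such that \<open>L\<close> and \<open>M\<close> generate \<open>A\<close>,
  so \<open>A / \<ell>A\<close> is a quotient of \<open>K[M]\<close> and has at most one basis element in each degree. The
  generators of the strings are a basis of \<open>A / \<ell>A\<close>; hence at most one string starts in each
  degree (\<open>string_degrees_distinct\<close>). The same reasoning applied to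
  \<open>A / (0 : \<ell>\<^sup>q)\<close>, whose strings are those of \<open>A\<close> of length greater than \<open>q\<close> with \<open>q\<close> elements
  removed, shows that the starting degrees of the strings longer than \<open>q\<close> form an initial segment
  of the natural numbers (\<open>string_predecessor\<close>). So the lengths decrease weakly with the starting
  degree: the longest string starts in degree \<open>0\<close>, the next one in degree \<open>1\<close>, and so on, and the
  partition determines the degree type (\<open>staircase_count\<close>).

  If \<open>\<ell> = 0\<close>, every string has length one and the degree type is the Hilbert function \<open>h\<close> of \<open>A\<close>,
  while the partition only records the dimension of \<open>A\<close>. In codimension two \<open>h i \<le> i + 1\<close>, and \<open>h\<close>
  does not increase any more once \<open>h i \<le> i\<close> (\<open>hilbert_nonincreasing\<close>). The Gorenstein property makes
  \<open>h\<close> symmetric (\<open>hilbert_symmetric\<close>). These facts force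
  \<open>h i = min (i + 1) (min a (d + 1 - i))\<close> for some \<open>a\<close> and all \<open>i \<le> d\<close>; these functions increase
  weakly with \<open>a\<close> at every \<open>i\<close>, so their sum, the dimension of \<open>A\<close>, determines them
  (\<open>symmetric_unimodal_eq_if_sum_eq\<close>).

  The two cases are told apart by the partition: some part differs from \<open>1\<close> exactly when
  \<open>\<ell> \<noteq> 0\<close>. A given partition may come from a decomposition other than the homogeneous one, but
  the lengths of the strings are determined by the dimensions of the \<open>\<ell>\<^sup>iA\<close>
  (\<open>string_lengths_unique\<close>). All linear algebra in \<open>A\<close> is done with polynomials modulo \<open>I\<close>.
\<close>

section \<open>Linear systems\<close>

text \<open>
  Gaussian elimination: if the equation \<open>y\<close> has a nonzero coefficient at \<open>x0\<close>, it is solved for the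
  unknown \<open>x0\<close> and substituted in the other equations.
\<close>

lemma homogeneous_system_nontrivial_solution:
  fixes a :: "'x \<Rightarrow> 'y \<Rightarrow> 'k::field"
  assumes "finite Y" "finite X" "card Y < card X"
  shows "\<exists>c. (\<exists>x\<in>X. c x \<noteq> 0) \<and> (\<forall>y\<in>Y. (\<Sum>x\<in>X. c x * a x y) = 0)"
  using assms
proof (induction Y arbitrary: X a rule: finite_induct)
  case empty
  then have "X \<noteq> {}" by auto
  then show ?case by (intro exI[of _ "\<lambda>_. 1"]) auto
next
  case (insert y Y)
  show ?case
  proof (cases "\<forall>x\<in>X. a x y = 0")
    case True
    have "card Y < card X" using insert.hyps insert.prems by simp
    then obtain c where "\<exists>x\<in>X. c x \<noteq> 0" "\<forall>y\<in>Y. (\<Sum>x\<in>X. c x * a x y) = 0"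
      using insert.IH[OF insert.prems(1), of a] by blast
    then show ?thesis using True by (intro exI[of _ c]) auto
  next
    case False
    then obtain x0 where x0: "x0 \<in> X" "a x0 y \<noteq> 0" by blast
    define X' where "X' = X - {x0}"
    have fin: "finite X'" and card: "card Y < card X'"
      using insert.hyps insert.prems x0 by (auto simp: X'_def)
    define a' where "a' x v = a x v - a x y / a x0 y * a x0 v" for x v
    obtain c where nz: "\<exists>x\<in>X'. c x \<noteq> 0" and c: "\<And>v. v \<in> Y \<Longrightarrow> (\<Sum>x\<in>X'. c x * a' x v) = 0"
      using insert.IH[OF fin card, of a'] by blast
    define r where "r = (\<Sum>x\<in>X'. c x * (a x y / a x0 y))"
    define c' where "c' x = (if x = x0 then - r else c x)" for x
    have split: "(\<Sum>x\<in>X. c' x * a x v) = (\<Sum>x\<in>X'. c x * a x v) - r * a x0 v" for v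
    proof -
      have "(\<Sum>x\<in>X. c' x * a x v) = c' x0 * a x0 v + (\<Sum>x\<in>X'. c' x * a x v)"
        unfolding X'_def using insert.prems(1) x0(1) by (rule sum.remove)
      also have "(\<Sum>x\<in>X'. c' x * a x v) = (\<Sum>x\<in>X'. c x * a x v)"
        by (rule sum.cong) (auto simp: c'_def X'_def)
      finally show ?thesis by (simp add: c'_def)
    qed
    have "(\<Sum>x\<in>X. c' x * a x v) = 0" if "v \<in> insert y Y" for v
    proof (cases "v = y")
      case True
      have "r * a x0 y = (\<Sum>x\<in>X'. c x * a x y)"
        using x0(2) by (simp add: r_def sum_distrib_right)
      then show ?thesis using split[of y] True by simp
    next
      case False
      have "(\<Sum>x\<in>X'. c x * a x v) - r * a x0 v = (\<Sum>x\<in>X'. c x * a' x v)"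
        by (simp add: r_def a'_def sum_distrib_right right_diff_distrib sum_subtractf mult.assoc)
      then show ?thesis using split[of v] c[of v] False that by simp
    qed
    moreover have "\<exists>x\<in>X. c' x \<noteq> 0" using nz by (auto simp: c'_def X'_def)
    ultimately show ?thesis by blast
  qed
qed

section \<open>Partitions, starting degrees and symmetric sequences\<close>

text \<open>
  The sum of the \<open>x - i\<close> drops by the number of parts greater than \<open>i\<close> when \<open>i\<close> grows by one, and
  these numbers give the multiplicity of each positive part.
\<close>

lemma multiset_eq_if_truncated_sums_eq:
  fixes P Q :: "nat multiset"
  assumes "0 \<notin># P" "0 \<notin># Q"
    and "\<And>i. (\<Sum>x\<in>#P. x - i) = (\<Sum>x\<in>#Q. x - i)"
  shows "P = Q"
proof (rule multiset_eqI)
  fix x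
  have above: "(\<Sum>y\<in>#R. y - i) = (\<Sum>y\<in>#R. y - Suc i) + size {#y \<in># R. i < y#}" for R :: "nat multiset" and i
    by (induction R) auto
  have eq: "size {#y \<in># P. i < y#} = size {#y \<in># Q. i < y#}" for i
    using above[of i P] above[of i Q] assms(3)[of i] assms(3)[of "Suc i"] by simp
  have cnt: "size {#y \<in># R. i < y#} = size {#y \<in># R. Suc i < y#} + count R (Suc i)" for R :: "nat multiset" and i
    by (induction R) auto
  show "count P x = count Q x"
  proof (cases x)
    case 0
    then show ?thesis using assms(1,2) by (metis not_in_iff)
  next
    case (Suc i)
    then show ?thesis using cnt[of i P] cnt[of i Q] eq[of i] eq[of "Suc i"] by simp
  qed
qed

lemma downward_closed_eq_lessThan_card:
  fixes E :: "nat set"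
  assumes "finite E" and down: "\<And>i. Suc i \<in> E \<Longrightarrow> i \<in> E"
  shows "E = {..<card E}"
proof -
  have down': "i \<in> E \<Longrightarrow> j \<le> i \<Longrightarrow> j \<in> E" for i j
    by (induction i) (auto simp: le_Suc_eq dest: down)
  have "{..m} \<subseteq> E" if "m \<in> E" for m using down'[OF that] by auto
  then have "m < card E" if "m \<in> E" for m
    using card_mono[OF assms(1), of "{..m}"] that by fastforce
  then have "E \<subseteq> {..<card E}" by auto
  then show ?thesis by (intro card_subset_eq) auto
qed

text \<open>
  Read \<open>p\<close> as the lengths of strings and \<open>e\<close> as their starting degrees. The hypotheses imply that the
  starting degrees of the strings of length at least \<open>q\<close> are the numbers below \<open>n q\<close>, so that the
  string starting in degree \<open>i\<close> has length \<open>q\<close> exactly if \<open>n (Suc q) \<le> i < n q\<close>. The right-hand side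
  depends only on the multiset of the lengths.
\<close>

lemma staircase_count:
  fixes p e :: "'x \<Rightarrow> nat"
  assumes "finite X" and inj: "inj_on e X"
    and down: "\<And>x. x \<in> X \<Longrightarrow> 0 < e x \<Longrightarrow> \<exists>y\<in>X. Suc (e y) = e x \<and> p x \<le> p y"
  defines "n \<equiv> \<lambda>q. size {#r \<in># image_mset p (mset_set X). q \<le> r#}"
  shows "count (image_mset (\<lambda>x. (p x, e x)) (mset_set X)) (q, i)
    = (if i < n q \<and> \<not> i < n (Suc q) then 1 else 0)"
proof -
  define E where "E q = e ` {x \<in> X. q \<le> p x}" for q
  have E: "E q = {..<n q}" for q
  proof -
    have "E q = {..<card (E q)}"
    proof (rule downward_closed_eq_lessThan_card)
      show "finite (E q)" using assms(1) by (simp add: E_def)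
    next
      fix i assume "Suc i \<in> E q"
      then obtain x where x: "x \<in> X" "q \<le> p x" "e x = Suc i" by (auto simp: E_def)
      then obtain y where "y \<in> X" "Suc (e y) = e x" "p x \<le> p y" using down[of x] by auto
      then show "i \<in> E q" using x by (auto simp: E_def intro!: image_eqI[of _ _ y])
    qed
    moreover have "card (E q) = card {x \<in> X. q \<le> p x}"
      unfolding E_def by (intro card_image inj_on_subset[OF inj]) auto
    moreover have "n q = card {x \<in> X. q \<le> p x}"
      unfolding n_def using assms(1) by (simp add: filter_mset_image_mset)
    ultimately show ?thesis by simp
  qed
  have "count (image_mset (\<lambda>x. (p x, e x)) (mset_set X)) (q, i) = card {x \<in> X. p x = q \<and> e x = i}"
    using assms(1) by (simp add: count_image_mset Int_def vimage_def conj_commute)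
  also have "\<dots> = (if i \<in> E q - E (Suc q) then 1 else 0)"
  proof (cases "i \<in> E q - E (Suc q)")
    case True
    then obtain x where x: "x \<in> X" "e x = i" "q \<le> p x" by (auto simp: E_def)
    moreover have "\<not> Suc q \<le> p x" using True x by (auto simp: E_def)
    ultimately have "{x \<in> X. p x = q \<and> e x = i} = {x}"
      using inj by (auto dest: inj_onD)
    then show ?thesis using True by simp
  next
    case False
    have "{x \<in> X. p x = q \<and> e x = i} = {}"
    proof (rule ccontr)
      assume "{x \<in> X. p x = q \<and> e x = i} \<noteq> {}"
      then obtain x where x: "x \<in> X" "p x = q" "e x = i" by auto
      then have "i \<in> E q" by (auto simp: E_def)
      then obtain y where "y \<in> X" "Suc q \<le> p y" "e y = i" using False by (auto simp: E_def)
      then show False using x inj by (metis inj_onD not_less_eq_eq order_refl)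
    qed
    with False show ?thesis by (simp only: card.empty if_False)
  qed
  finally show ?thesis by (simp add: E)
qed

text \<open>
  The number \<open>a\<close> is the first index with \<open>h a \<le> a\<close>. Before \<open>a\<close> the sequence is \<open>i + 1\<close> and from
  \<open>a - 1\<close> on it does not increase; if \<open>0 < a\<close>, by symmetry it has the value \<open>a\<close> again at
  \<open>d - (a - 1)\<close>, so it is constant between these two indices.
\<close>

lemma symmetric_unimodal_eq_min:
  fixes h :: "nat \<Rightarrow> nat"
  assumes bound: "\<And>i. h i \<le> Suc i"
    and desc: "\<And>i. h i \<le> i \<Longrightarrow> h (Suc i) \<le> h i"
    and sym: "\<And>i. i \<le> d \<Longrightarrow> h i = h (d - i)"
    and zero: "\<And>i. d < i \<Longrightarrow> h i = 0"
  obtains a where "\<And>i. i \<le> d \<Longrightarrow> h i = min (Suc i) (min a (Suc (d - i)))"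
proof -
  define a where "a = (LEAST i. h i \<le> i)"
  have "h (Suc d) \<le> Suc d" using zero[of "Suc d"] by simp
  then have a: "h a \<le> a" unfolding a_def by (rule LeastI)
  have low: "h i = Suc i" if "i < a" for i
    using not_less_Least[of i "\<lambda>i. h i \<le> i"] that bound[of i] by (simp add: a_def)
  have anti: "h j \<le> h i \<and> h j \<le> a" if "a \<le> i" "i \<le> j" for i j
  proof -
    have ha: "h i \<le> a" if "a \<le> i" for i
      using that by (induction rule: dec_induct) (use a desc le_trans in blast)+
    have "h j \<le> h i"
      using that(2)
    proof (induction rule: dec_induct)
      case (step n)
      have "h n \<le> n" using ha[of n] step.hyps that(1) by simp
      then show ?case using desc[of n] step.IH by simp
    qed simp
    then show ?thesis using ha[of j] that by simp
  qed
  have "h i = min (Suc i) (min a (Suc (d - i)))" if i: "i \<le> d" for i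
  proof (rule antisym)
    have "h i \<le> a"
      using low[of i] anti[of i i] by (cases "i < a") auto
    then show "h i \<le> min (Suc i) (min a (Suc (d - i)))"
      using bound[of i] bound[of "d - i"] sym[OF i] by simp
  next
    show "min (Suc i) (min a (Suc (d - i))) \<le> h i"
    proof (rule ccontr)
      assume "\<not> ?thesis"
      then have lt: "h i \<le> i" "h i < a" "h (d - i) \<le> d - i" using sym[OF i] by auto
      then have ge: "a \<le> i" "a \<le> d - i" using low[of i] low[of "d - i"]
        by (auto simp: not_less[symmetric])
      define k where "k = d - (a - 1)"
      have "h k = a" using sym[of "a - 1"] low[of "a - 1"] lt ge by (simp add: k_def)
      moreover have "i \<le> k" using ge lt by (simp add: k_def)
      ultimately show False using anti[of i k] ge lt by simp
    qed
  qed
  then show ?thesis using that by blast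
qed

lemma symmetric_unimodal_eq_if_sum_eq:
  fixes h h' :: "nat \<Rightarrow> nat"
  assumes "\<And>i. h i \<le> Suc i" "\<And>i. h i \<le> i \<Longrightarrow> h (Suc i) \<le> h i"
    and "\<And>i. i \<le> d \<Longrightarrow> h i = h (d - i)" "\<And>i. d < i \<Longrightarrow> h i = 0"
    and "\<And>i. h' i \<le> Suc i" "\<And>i. h' i \<le> i \<Longrightarrow> h' (Suc i) \<le> h' i"
    and "\<And>i. i \<le> d \<Longrightarrow> h' i = h' (d - i)" "\<And>i. d < i \<Longrightarrow> h' i = 0"
    and sum: "(\<Sum>i\<le>d. h i) = (\<Sum>i\<le>d. h' i)"
  shows "h = h'"
proof -
  obtain a where a: "\<And>i. i \<le> d \<Longrightarrow> h i = min (Suc i) (min a (Suc (d - i)))"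
    using symmetric_unimodal_eq_min[of h d] assms(1-4) by blast
  obtain a' where a': "\<And>i. i \<le> d \<Longrightarrow> h' i = min (Suc i) (min a' (Suc (d - i)))"
    using symmetric_unimodal_eq_min[of h' d] assms(5-8) by blast
  have "h i = h' i" if "i \<le> d" for i
  proof (cases "a \<le> a'")
    case True
    then have "\<And>i. i \<in> {..d} \<Longrightarrow> h i \<le> h' i" using a a' by auto
    then show ?thesis using sum_mono_inv[OF sum] that by auto
  next
    case False
    then have "\<And>i. i \<in> {..d} \<Longrightarrow> h' i \<le> h i" using a a' by auto
    then show ?thesis using sum_mono_inv[OF sum[symmetric]] that by fastforce
  qed
  then show ?thesis using assms(4,8) by (metis ext not_less)
qed

section \<open>Constants, forms and homogeneous parts\<close>

lemma const_poly_simps [simp]: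
  "const_poly 0 = 0" "const_poly 1 = 1"
  by (simp_all add: const_poly_def)

lemma const_poly_add: "const_poly (a + b) = const_poly a + const_poly b"
  by (simp add: const_poly_def single_add)

lemma const_poly_diff: "const_poly (a - b) = const_poly a - const_poly b"
  by (simp add: const_poly_def single_diff)

lemma const_poly_uminus: "const_poly (- a) = - const_poly a"
  by (simp add: const_poly_def single_uminus)

lemma const_poly_mult: "const_poly (a * b) = const_poly a * const_poly b"
  by (simp add: const_poly_def mult_single)

lemma const_poly_sum: "const_poly (\<Sum>x\<in>X. f x) = (\<Sum>x\<in>X. const_poly (f x))"
  by (induction X rule: infinite_finite_induct) (auto simp: const_poly_add)

lemma const_poly_mult_single: "const_poly c * Poly_Mapping.single m a = Poly_Mapping.single m (c * a)"
  by (simp add: const_poly_def mult_single)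

lemma sum_monomials:
  "f = (\<Sum>m\<in>Poly_Mapping.keys f. const_poly (Poly_Mapping.lookup f m) * Poly_Mapping.single m 1)"
  by (rule poly_mapping_eqI)
    (auto simp: lookup_sum const_poly_mult_single lookup_single when_def in_keys_iff)

lemma lookup_const_poly_mult:
  "Poly_Mapping.lookup (const_poly c * f) m = c * Poly_Mapping.lookup f m"
proof -
  have "const_poly c * f = (\<Sum>u\<in>Poly_Mapping.keys f. Poly_Mapping.single u (c * Poly_Mapping.lookup f u))"
    by (subst sum_monomials[of f]) (simp add: sum_distrib_left const_poly_mult_single)
  then show ?thesis by (auto simp: lookup_sum lookup_single when_def in_keys_iff)
qed

lemma monom_deg_simps [simp]:
  "monom_deg 0 = 0" "monom_deg (a + b) = monom_deg a + monom_deg b"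
  "monom_deg (Poly_Mapping.single i n) = n"
  by (simp_all add: monom_deg_def lookup_add sum.distrib lookup_single when_def)

lemma forms_zero [simp]: "0 \<in> forms i"
  by (simp add: forms_def)

lemma forms_one [simp]: "1 \<in> forms 0"
  by (simp add: forms_def)

lemma forms_single: "monom_deg m = i \<Longrightarrow> Poly_Mapping.single m c \<in> forms i"
  by (simp add: forms_def)

lemma forms_add: "f \<in> forms i \<Longrightarrow> g \<in> forms i \<Longrightarrow> f + g \<in> forms i"
  using keys_add[of f g] by (auto simp: forms_def)

lemma forms_mult:
  fixes f g :: "('n::finite, 'k::field_char_0) mpoly"
  assumes "f \<in> forms i" "g \<in> forms j"
  shows "f * g \<in> forms (i + j)"
  unfolding forms_def
proof (intro CollectI ballI)
  fix m assume "m \<in> Poly_Mapping.keys (f * g)"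
  then obtain a b where "m = a + b" "a \<in> Poly_Mapping.keys f" "b \<in> Poly_Mapping.keys g"
    using keys_mult[of f g] by auto
  then show "monom_deg m = i + j" using assms by (auto simp: forms_def)
qed

lemma forms_const_mult: "f \<in> forms i \<Longrightarrow> const_poly c * f \<in> forms i"
  using forms_mult[of "const_poly c" 0 f i] by (simp add: const_poly_def forms_single)

lemma forms_sum: "(\<And>x. x \<in> X \<Longrightarrow> f x \<in> forms i) \<Longrightarrow> (\<Sum>x\<in>X. f x) \<in> forms i"
  by (induction X rule: infinite_finite_induct) (auto intro: forms_add)

lemma forms_power:
  fixes f :: "('n::finite, 'k::field_char_0) mpoly"
  shows "f \<in> forms 1 \<Longrightarrow> f ^ n \<in> forms n"
  by (induction n) (use forms_mult[of f 1] in auto)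

lemma lookup_hom_part:
  "Poly_Mapping.lookup (hom_part i f) m = (if monom_deg m = i then Poly_Mapping.lookup f m else 0)"
  by (auto simp: hom_part_def lookup_sum lookup_single when_def in_keys_iff)

lemma hom_part_add: "hom_part i (f + g) = hom_part i f + hom_part i g"
  by (rule poly_mapping_eqI) (simp add: lookup_hom_part lookup_add)

lemma hom_part_diff: "hom_part i (f - g) = hom_part i f - hom_part i g"
  by (rule poly_mapping_eqI) (simp add: lookup_hom_part lookup_minus)

lemma hom_part_zero [simp]: "hom_part i 0 = 0"
  by (rule poly_mapping_eqI) (simp add: lookup_hom_part)

lemma hom_part_sum: "hom_part i (\<Sum>x\<in>X. f x) = (\<Sum>x\<in>X. hom_part i (f x))"
  by (induction X rule: infinite_finite_induct) (auto simp: hom_part_add)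

lemma hom_part_form: "f \<in> forms j \<Longrightarrow> hom_part i f = (if i = j then f else 0)"
  by (rule poly_mapping_eqI) (auto simp: lookup_hom_part forms_def in_keys_iff)

section \<open>Linear algebra modulo an ideal\<close>

locale poly_ideal =
  fixes I :: "('n::finite, 'k::field_char_0) mpoly set"
  assumes ideal: "ideal I poly_ring"
begin

lemma zero_mem [simp]: "0 \<in> I"
  using additive_subgroup.zero_closed[OF ideal.axioms(1)[OF ideal]] by simp

lemma add_mem: "f \<in> I \<Longrightarrow> g \<in> I \<Longrightarrow> f + g \<in> I"
  using additive_subgroup.a_closed[OF ideal.axioms(1)[OF ideal]] by simp

lemma mult_mem: "f \<in> I \<Longrightarrow> g * f \<in> I"
  using ideal.I_l_closed[OF ideal] by simp

lemma uminus_mem: "f \<in> I \<Longrightarrow> - f \<in> I"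
  using mult_mem[of f "- 1"] by simp

lemma diff_mem: "f \<in> I \<Longrightarrow> g \<in> I \<Longrightarrow> f - g \<in> I"
  using add_mem[OF _ uminus_mem] by force

lemma sum_mem: "(\<And>x. x \<in> X \<Longrightarrow> f x \<in> I) \<Longrightarrow> (\<Sum>x\<in>X. f x) \<in> I"
  by (induction X rule: infinite_finite_induct) (auto intro: add_mem)

text \<open>
  The families are indexed by sets, so that repeated members count as dependent. The notions
  \<open>indep_mod\<close> and \<open>span_mod\<close> are linear independence and span of the residue classes in the quotient
  by \<open>I\<close>.
\<close>

definition lincomb :: "('x \<Rightarrow> ('n, 'k) mpoly) \<Rightarrow> 'x set \<Rightarrow> ('x \<Rightarrow> 'k) \<Rightarrow> ('n, 'k) mpoly" where
  "lincomb b X c = (\<Sum>x\<in>X. const_poly (c x) * b x)"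

definition indep_mod :: "('x \<Rightarrow> ('n, 'k) mpoly) \<Rightarrow> 'x set \<Rightarrow> bool" where
  "indep_mod b X \<longleftrightarrow> (\<forall>c. lincomb b X c \<in> I \<longrightarrow> (\<forall>x\<in>X. c x = 0))"

definition span_mod :: "('x \<Rightarrow> ('n, 'k) mpoly) \<Rightarrow> 'x set \<Rightarrow> ('n, 'k) mpoly set" where
  "span_mod b X = {f. \<exists>c. f - lincomb b X c \<in> I}"

lemma lincomb_add: "lincomb b X (\<lambda>x. c x + d x) = lincomb b X c + lincomb b X d"
  by (simp add: lincomb_def const_poly_add distrib_right sum.distrib)

lemma lincomb_scale: "lincomb b X (\<lambda>x. a * c x) = const_poly a * lincomb b X c"
  by (simp add: lincomb_def const_poly_mult sum_distrib_left mult.assoc)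

lemma span_mod_cong: "g \<in> span_mod b X \<Longrightarrow> f - g \<in> I \<Longrightarrow> f \<in> span_mod b X"
proof -
  assume "g \<in> span_mod b X" "f - g \<in> I"
  then obtain c where "g - lincomb b X c \<in> I" by (auto simp: span_mod_def)
  from add_mem[OF \<open>f - g \<in> I\<close> this] show ?thesis by (auto simp: span_mod_def)
qed

lemma span_mod_ideal: "f \<in> I \<Longrightarrow> f \<in> span_mod b X"
  unfolding span_mod_def by (auto intro!: exI[of _ "\<lambda>_. 0"] simp: lincomb_def)

lemma span_mod_add: "f \<in> span_mod b X \<Longrightarrow> g \<in> span_mod b X \<Longrightarrow> f + g \<in> span_mod b X"
proof -
  assume "f \<in> span_mod b X" "g \<in> span_mod b X"
  then obtain c d where "f - lincomb b X c \<in> I" "g - lincomb b X d \<in> I"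
    by (auto simp: span_mod_def)
  from add_mem[OF this] have "f + g - lincomb b X (\<lambda>x. c x + d x) \<in> I"
    by (simp add: lincomb_add algebra_simps)
  then show ?thesis by (auto simp: span_mod_def)
qed

lemma span_mod_scale: "f \<in> span_mod b X \<Longrightarrow> const_poly a * f \<in> span_mod b X"
proof -
  assume "f \<in> span_mod b X"
  then obtain c where "f - lincomb b X c \<in> I" by (auto simp: span_mod_def)
  from mult_mem[OF this, of "const_poly a"]
  have "const_poly a * f - lincomb b X (\<lambda>x. a * c x) \<in> I"
    by (simp add: lincomb_scale algebra_simps)
  then show ?thesis by (auto simp: span_mod_def)
qed

lemma span_mod_sum: "(\<And>x. x \<in> Y \<Longrightarrow> f x \<in> span_mod b X) \<Longrightarrow> (\<Sum>x\<in>Y. f x) \<in> span_mod b X"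
  by (induction Y rule: infinite_finite_induct) (auto intro: span_mod_add span_mod_ideal)

lemma span_mod_base:
  assumes "finite X" "x \<in> X"
  shows "b x \<in> span_mod b X"
proof -
  have "lincomb b X (\<lambda>y. if y = x then 1 else 0) = (\<Sum>y\<in>X. if y = x then b x else 0)"
    unfolding lincomb_def by (rule sum.cong) auto
  then have "b x - lincomb b X (\<lambda>y. if y = x then 1 else 0) \<in> I" using assms by simp
  then show ?thesis unfolding span_mod_def by blast
qed

text \<open>
  Multiplication by a fixed polynomial is linear on the quotient, so the image of a span is
  controlled by the images of the spanning elements.
\<close>

lemma span_mod_mult:
  assumes "f \<in> span_mod b X" and "\<And>x. x \<in> X \<Longrightarrow> h * b x \<in> span_mod b' Y"
  shows "h * f \<in> span_mod b' Y"
proof -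
  obtain c where c: "f - lincomb b X c \<in> I" using assms(1) by (auto simp: span_mod_def)
  have "h * lincomb b X c = (\<Sum>x\<in>X. const_poly (c x) * (h * b x))"
    by (simp add: lincomb_def sum_distrib_left mult.left_commute)
  then have "h * lincomb b X c \<in> span_mod b' Y"
    using assms(2) by (auto intro!: span_mod_sum span_mod_scale)
  moreover have "h * f - h * lincomb b X c \<in> I"
    using mult_mem[OF c, of h] by (simp add: algebra_simps)
  ultimately show ?thesis by (rule span_mod_cong)
qed

lemma span_mod_trans:
  assumes "f \<in> span_mod b X" and "\<And>x. x \<in> X \<Longrightarrow> b x \<in> span_mod b' Y"
  shows "f \<in> span_mod b' Y"
  using span_mod_mult[of f b X 1 b' Y] assms by simp

lemma span_mod_mono:
  assumes "X \<subseteq> Y" "finite Y" "f \<in> span_mod b X"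
  shows "f \<in> span_mod b Y"
  using assms(3) by (rule span_mod_trans) (use assms in \<open>auto intro: span_mod_base\<close>)

lemma indep_modD: "indep_mod b X \<Longrightarrow> lincomb b X c \<in> I \<Longrightarrow> x \<in> X \<Longrightarrow> c x = 0"
  by (simp add: indep_mod_def)

lemma indep_mod_subset:
  assumes "indep_mod b X" "Y \<subseteq> X" "finite X"
  shows "indep_mod b Y"
  unfolding indep_mod_def
proof (intro allI impI)
  fix c assume c: "lincomb b Y c \<in> I"
  have "lincomb b X (\<lambda>x. if x \<in> Y then c x else 0) = lincomb b Y c"
    unfolding lincomb_def by (rule sum.mono_neutral_cong_right) (use assms in auto)
  with c have "\<forall>x\<in>X. (if x \<in> Y then c x else 0) = 0"
    using indep_modD[OF assms(1), of "\<lambda>x. if x \<in> Y then c x else 0"] by simp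
  then show "\<forall>x\<in>Y. c x = 0" using assms(2) by (metis subsetD)
qed

lemma indep_mod_disjoint_span:
  assumes "indep_mod b X" "finite X" "Y \<subseteq> X" "Z \<subseteq> X" "Y \<inter> Z = {}"
    and "lincomb b Z c \<in> span_mod b Y" "x \<in> Z"
  shows "c x = 0"
proof -
  obtain d where d: "lincomb b Z c - lincomb b Y d \<in> I" using assms(6) by (auto simp: span_mod_def)
  let ?e = "\<lambda>x. if x \<in> Z then c x else - d x"
  have fin: "finite Y" "finite Z" using assms by (auto intro: finite_subset)
  have "lincomb b (Z \<union> Y) ?e = lincomb b Z ?e + lincomb b Y ?e"
    unfolding lincomb_def by (rule sum.union_disjoint) (use fin assms in auto)
  also have "lincomb b Z ?e = lincomb b Z c"
    unfolding lincomb_def by (rule sum.cong) auto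
  also have "lincomb b Y ?e = (\<Sum>x\<in>Y. - (const_poly (d x) * b x))"
    unfolding lincomb_def by (rule sum.cong) (use assms(5) in \<open>auto simp: const_poly_uminus\<close>)
  also have "\<dots> = - lincomb b Y d" by (simp add: lincomb_def sum_negf)
  finally have "lincomb b (Z \<union> Y) ?e \<in> I" using d by simp
  then have "?e x = 0"
    using indep_modD[OF indep_mod_subset[OF assms(1) _ assms(2), of "Z \<union> Y"], of ?e x] assms by simp
  then show ?thesis using assms(7) by simp
qed

lemma indep_mod_not_in_span:
  assumes "indep_mod b X" "finite X" "Y \<subseteq> X" "x \<in> X" "x \<notin> Y"
  shows "b x \<notin> span_mod b Y"
  using indep_mod_disjoint_span[OF assms(1-3), of "{x}" "\<lambda>_. 1" x] assms
  by (auto simp: lincomb_def)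

lemma card_le_if_indep_mod_span_mod:
  assumes "finite X" "finite Y" "indep_mod a X" "\<And>x. x \<in> X \<Longrightarrow> a x \<in> span_mod b Y"
  shows "card X \<le> card Y"
proof (rule ccontr)
  assume less: "\<not> card X \<le> card Y"
  have "\<forall>x\<in>X. \<exists>c. a x - lincomb b Y c \<in> I" using assms(4) by (auto simp: span_mod_def)
  then obtain m where m: "\<And>x. x \<in> X \<Longrightarrow> a x - lincomb b Y (m x) \<in> I" by metis
  obtain c where nz: "\<exists>x\<in>X. c x \<noteq> 0" and c: "\<And>y. y \<in> Y \<Longrightarrow> (\<Sum>x\<in>X. c x * m x y) = 0"
    using homogeneous_system_nontrivial_solution[of Y X m] assms less by auto
  have "(\<Sum>x\<in>X. const_poly (c x) * lincomb b Y (m x))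
      = (\<Sum>x\<in>X. \<Sum>y\<in>Y. const_poly (c x * m x y) * b y)"
    by (simp add: lincomb_def sum_distrib_left const_poly_mult mult.assoc)
  also have "\<dots> = (\<Sum>y\<in>Y. const_poly (\<Sum>x\<in>X. c x * m x y) * b y)"
    by (subst sum.swap) (simp add: const_poly_sum sum_distrib_right)
  finally have 0: "(\<Sum>x\<in>X. const_poly (c x) * lincomb b Y (m x)) = 0" by (simp add: c)
  have "(\<Sum>x\<in>X. const_poly (c x) * (a x - lincomb b Y (m x))) \<in> I"
    by (intro sum_mem mult_mem m)
  also have "(\<Sum>x\<in>X. const_poly (c x) * (a x - lincomb b Y (m x))) = lincomb a X c"
    using 0 by (simp add: right_diff_distrib sum_subtractf lincomb_def)
  finally show False using assms(3) nz by (auto simp: indep_mod_def)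
qed

text \<open>
  Keeping each member of a sequence that does not depend on its predecessors leaves a basis of the
  span. Applied to monomials in a suitable order this gives the monomials outside the initial ideal.
\<close>

lemma greedy_basis:
  fixes u :: "nat \<Rightarrow> ('n, 'k) mpoly" and n :: nat
  defines "S \<equiv> {a. a < n \<and> u a \<notin> span_mod u {..<a}}"
  shows "indep_mod u S" and "\<And>a. a < n \<Longrightarrow> u a \<in> span_mod u S"
proof -
  have fin: "finite S" by (simp add: S_def)
  show "indep_mod u S"
    unfolding indep_mod_def
  proof (intro allI impI, rule ccontr)
    fix c assume c: "lincomb u S c \<in> I" and "\<not> (\<forall>x\<in>S. c x = 0)"
    \<comment> \<open>The last member with a nonzero coefficient would depend on earlier ones.\<close>
    define N where "N = {a \<in> S. c a \<noteq> 0}"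
    have N: "finite N" "N \<noteq> {}" using fin \<open>\<not> (\<forall>x\<in>S. c x = 0)\<close> by (auto simp: N_def)
    define a where "a = Max N"
    have a: "a \<in> S" "c a \<noteq> 0" using Max_in[OF N] by (auto simp: a_def N_def)
    have N_sub: "N - {a} \<subseteq> {..<a}" using Max_ge[OF N(1)] by (auto simp: a_def le_less)
    have "lincomb u S c = lincomb u N c"
      unfolding lincomb_def by (rule sum.mono_neutral_right) (auto simp: N_def fin)
    also have "\<dots> = const_poly (c a) * u a + lincomb u (N - {a}) c"
      unfolding lincomb_def using N(1) Max_in[OF N] by (subst sum.remove[of _ a]) (auto simp: a_def)
    finally have "const_poly (inverse (c a)) * (const_poly (c a) * u a + lincomb u (N - {a}) c) \<in> I"
      using mult_mem[OF c] by simp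
    moreover have "const_poly (inverse (c a)) * (const_poly (c a) * u a + lincomb u (N - {a}) c)
      = u a - lincomb u (N - {a}) (\<lambda>x. - inverse (c a) * c x)"
    proof -
      have "const_poly (inverse (c a)) * const_poly (c a) = (1 :: ('n, 'k) mpoly)"
        using a(2) by (simp flip: const_poly_mult)
      then show ?thesis
        unfolding lincomb_scale const_poly_uminus by (simp add: distrib_left flip: mult.assoc)
    qed
    ultimately have "u a \<in> span_mod u (N - {a})" unfolding span_mod_def by auto
    then have "u a \<in> span_mod u {..<a}" using N_sub span_mod_mono by blast
    then show False using a(1) by (simp add: S_def)
  qed
  show "u a \<in> span_mod u S" if "a < n" for a
    using that
  proof (induction a rule: less_induct)
    case (less a)
    show ?case
    proof (cases "a \<in> S")
      case True
      then show ?thesis by (rule span_mod_base[OF fin])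
    next
      case False
      then have "u a \<in> span_mod u {..<a}" using less.prems by (simp add: S_def)
      then show ?thesis by (rule span_mod_trans) (use less in auto)
    qed
  qed
qed

section \<open>Strings in codimension two\<close>

definition linear_forms_gen :: "('n, 'k) mpoly \<Rightarrow> ('n, 'k) mpoly \<Rightarrow> bool" where
  "linear_forms_gen U V \<longleftrightarrow>
     (\<forall>f\<in>forms 1. \<exists>a b. f - (const_poly a * U + const_poly b * V) \<in> I)"

text \<open>
  The quotient is generated by its linear forms, each of which is a combination of \<open>U\<close> and \<open>V\<close>; so
  modulo \<open>I\<close> everything is a polynomial in \<open>U\<close> and \<open>V\<close>, whatever the number of variables.
\<close>

lemma form_in_span_monomials:
  assumes gen: "linear_forms_gen U V" and "f \<in> forms i"
  shows "f \<in> span_mod (\<lambda>a. U ^ a * V ^ (i - a)) {..i}"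
proof -
  have monom: "Poly_Mapping.single m 1 \<in> span_mod (\<lambda>a. U ^ a * V ^ (i - a)) {..i}"
    if "monom_deg m = i" for m i
    using that
  proof (induction i arbitrary: m)
    case 0
    then have "m = 0" by (intro poly_mapping_eqI) (simp add: monom_deg_def)
    then show ?case using span_mod_base[of "{..0}" 0 "\<lambda>a. U ^ a * V ^ (0 - a)"] by simp
  next
    case (Suc i)
    have "\<not> (\<forall>v. Poly_Mapping.lookup m v = 0)"
    proof
      assume "\<forall>v. Poly_Mapping.lookup m v = 0"
      then have "monom_deg m = 0" by (simp add: monom_deg_def)
      then show False using Suc.prems by simp
    qed
    then obtain v where v: "Poly_Mapping.lookup m v \<noteq> 0" by blast
    define w where "w = m - Poly_Mapping.single v 1"
    have m: "m = Poly_Mapping.single v 1 + w"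
      using v by (intro poly_mapping_eqI) (auto simp: w_def lookup_add lookup_minus lookup_single when_def)
    let ?x = "Poly_Mapping.single (Poly_Mapping.single v 1) 1 :: ('n, 'k) mpoly"
    let ?y = "Poly_Mapping.single w 1 :: ('n, 'k) mpoly"
    let ?S = "span_mod (\<lambda>a. U ^ a * V ^ (Suc i - a)) {..Suc i}"
    have xy: "Poly_Mapping.single m 1 = ?x * ?y" by (simp add: m mult_single)
    have y: "?y \<in> span_mod (\<lambda>a. U ^ a * V ^ (i - a)) {..i}"
      using Suc m by simp
    have base: "U ^ a * V ^ (Suc i - a) \<in> ?S" if "a \<le> Suc i" for a
      using span_mod_base[of "{..Suc i}" a "\<lambda>a. U ^ a * V ^ (Suc i - a)"] that by simp
    have U: "U * ?y \<in> ?S"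
      using y by (rule span_mod_mult) (use base[of "Suc a" for a] in \<open>simp add: mult.assoc\<close>)
    have V: "V * ?y \<in> ?S"
      using y
    proof (rule span_mod_mult)
      fix a assume "a \<in> {..i}"
      then have "V * (U ^ a * V ^ (i - a)) = U ^ a * V ^ (Suc i - a)"
        by (simp add: Suc_diff_le mult.left_commute)
      then show "V * (U ^ a * V ^ (i - a)) \<in> ?S" using base[of a] \<open>a \<in> {..i}\<close> by simp
    qed
    have "?x \<in> forms 1" by (simp add: forms_single)
    then obtain a b where "?x - (const_poly a * U + const_poly b * V) \<in> I"
      using gen by (auto simp: linear_forms_gen_def)
    from mult_mem[OF this, of ?y]
    have "?x * ?y - (const_poly a * (U * ?y) + const_poly b * (V * ?y)) \<in> I"
      by (simp add: algebra_simps)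
    then show ?case
      unfolding xy by (rule span_mod_cong[OF span_mod_add[OF span_mod_scale[OF U] span_mod_scale[OF V]]])
  qed
  have "(\<Sum>m\<in>Poly_Mapping.keys f. const_poly (Poly_Mapping.lookup f m) * Poly_Mapping.single m 1)
      \<in> span_mod (\<lambda>a. U ^ a * V ^ (i - a)) {..i}"
    using assms(2) by (intro span_mod_sum span_mod_scale monom) (auto simp: forms_def)
  then show ?thesis by (simp flip: sum_monomials)
qed

text \<open>
  In other words, modulo \<open>I\<close> and \<open>L\<close> the forms of degree \<open>i\<close> are the multiples of \<open>M ^ i\<close>.
\<close>

lemma form_eq_power_plus_multiple:
  assumes "linear_forms_gen L M" and "f \<in> forms i"
  obtains c w where "f - (const_poly c * M ^ i + L * w) \<in> I"
proof -
  obtain c where c: "f - lincomb (\<lambda>a. L ^ a * M ^ (i - a)) {..i} c \<in> I"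
    using form_in_span_monomials[OF assms] by (auto simp: span_mod_def)
  have "lincomb (\<lambda>a. L ^ a * M ^ (i - a)) {..i} c
      = const_poly (c 0) * M ^ i + L * (\<Sum>a<i. const_poly (c (Suc a)) * (L ^ a * M ^ (i - Suc a)))"
    unfolding lincomb_def
    by (simp add: sum.atMost_shift sum_distrib_left mult_ac)
  then show ?thesis using c that by simp
qed

text \<open>
  The Jordan decompositions of the multiplication by \<open>L\<close>, in terms of representatives \<open>z k\<close> of the
  generators of the strings; the index \<open>(k, j)\<close> stands for the \<open>j\<close>-th element of the \<open>k\<close>-th string.
\<close>

definition string_basis ::
  "('n, 'k) mpoly \<Rightarrow> nat \<Rightarrow> (nat \<Rightarrow> ('n, 'k) mpoly) \<Rightarrow> (nat \<Rightarrow> nat) \<Rightarrow> bool" where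
  "string_basis L t z p \<longleftrightarrow>
     (\<forall>k<t. 0 < p k \<and> L ^ p k * z k \<in> I) \<and>
     indep_mod (\<lambda>(k, j). L ^ j * z k) (SIGMA k:{..<t}. {..<p k}) \<and>
     span_mod (\<lambda>(k, j). L ^ j * z k) (SIGMA k:{..<t}. {..<p k}) = UNIV"

lemma string_basisD:
  assumes "string_basis L t z p"
  shows "k < t \<Longrightarrow> 0 < p k" "k < t \<Longrightarrow> p k \<le> i \<Longrightarrow> L ^ i * z k \<in> I"
    "indep_mod (\<lambda>(k, j). L ^ j * z k) (SIGMA k:{..<t}. {..<p k})"
    "f \<in> span_mod (\<lambda>(k, j). L ^ j * z k) (SIGMA k:{..<t}. {..<p k})"
proof -
  assume "k < t" "p k \<le> i"
  then have "L ^ p k * z k \<in> I" using assms by (auto simp: string_basis_def)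
  from mult_mem[OF this, of "L ^ (i - p k)"] show "L ^ i * z k \<in> I"
    using \<open>p k \<le> i\<close> by (simp add: mult.assoc[symmetric] power_add[symmetric])
qed (use assms in \<open>auto simp: string_basis_def\<close>)

text \<open>
  The image of \<open>L ^ i\<close> is spanned by the strings without their first \<open>i\<close> elements.
\<close>

lemma power_mult_in_span_tails:
  assumes basis: "string_basis L t z p"
  shows "L ^ i * f \<in> span_mod (\<lambda>(k, j). L ^ j * z k) (SIGMA k:{..<t}. {i..<p k})"
  using string_basisD(4)[OF basis]
proof (rule span_mod_mult)
  fix x assume "x \<in> (SIGMA k:{..<t}. {..<p k})"
  then obtain k j where x: "x = (k, j)" "k < t" by auto
  have eq: "L ^ i * (case x of (k, j) \<Rightarrow> L ^ j * z k) = L ^ (i + j) * z k"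
    by (simp add: x power_add mult.assoc)
  show "L ^ i * (case x of (k, j) \<Rightarrow> L ^ j * z k)
      \<in> span_mod (\<lambda>(k, j). L ^ j * z k) (SIGMA k:{..<t}. {i..<p k})"
    unfolding eq
  proof (cases "i + j < p k")
    case True
    then show "L ^ (i + j) * z k \<in> span_mod (\<lambda>(k, j). L ^ j * z k) (SIGMA k:{..<t}. {i..<p k})"
      using span_mod_base[of "SIGMA k:{..<t}. {i..<p k}" "(k, i + j)" "\<lambda>(k, j). L ^ j * z k"] x
      by simp
  next
    case False
    then show "L ^ (i + j) * z k \<in> span_mod (\<lambda>(k, j). L ^ j * z k) (SIGMA k:{..<t}. {i..<p k})"
      using string_basisD(2)[OF basis x(2)] by (simp add: span_mod_ideal)
  qed
qed

text \<open>
  The number of basis elements with \<open>i \<le> j\<close> is the dimension of the image of \<open>L ^ i\<close>, which does not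
  depend on the basis.
\<close>

lemma string_lengths_unique:
  assumes "string_basis L t z p" "string_basis L t' z' p'"
  shows "image_mset p (mset_set {..<t}) = image_mset p' (mset_set {..<t'})"
proof (rule multiset_eq_if_truncated_sums_eq)
  have le: "(\<Sum>k<t. p k - i) \<le> (\<Sum>k<t'. p' k - i)"
    if b: "string_basis L t z p" "string_basis L t' z' p'" for t z p t' z' p' i
  proof -
    let ?X = "SIGMA k:{..<t}. {i..<p k}" and ?Y = "SIGMA k:{..<t'}. {i..<p' k}"
    have "card ?X \<le> card ?Y"
    proof (rule card_le_if_indep_mod_span_mod)
      show "indep_mod (\<lambda>(k, j). L ^ j * z k) ?X"
        using string_basisD(3)[OF b(1)] by (rule indep_mod_subset) auto
    next
      fix x assume "x \<in> ?X"
      then obtain k j where x: "x = (k, j)" "i \<le> j" by auto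
      then have "(case x of (k, j) \<Rightarrow> L ^ j * z k) = L ^ i * (L ^ (j - i) * z k)"
        by (simp add: mult.assoc[symmetric] power_add[symmetric])
      then show "(case x of (k, j) \<Rightarrow> L ^ j * z k) \<in> span_mod (\<lambda>(k, j). L ^ j * z' k) ?Y"
        using power_mult_in_span_tails[OF b(2)] by simp
    qed auto
    then show ?thesis by simp
  qed
  show "(\<Sum>x\<in>#image_mset p (mset_set {..<t}). x - i) = (\<Sum>x\<in>#image_mset p' (mset_set {..<t'}). x - i)"
    for i
    using le[OF assms, of i] le[OF assms(2,1), of i]
    by (simp add: image_mset.compositionality o_def flip: sum_unfold_sum_mset)
next
  show "0 \<notin># image_mset p (mset_set {..<t})" "0 \<notin># image_mset p' (mset_set {..<t'})"
    using string_basisD(1)[OF assms(1)] string_basisD(1)[OF assms(2)] by force+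
qed

text \<open>
  Modulo \<open>I\<close> and \<open>L\<close>, two generators of the same degree \<open>i\<close> are both multiples of \<open>M ^ i\<close>, so a
  nontrivial combination of them is a multiple of \<open>L\<close>. But the multiples of \<open>L\<close> are spanned by the
  other elements of the strings.
\<close>

lemma string_degrees_distinct:
  assumes basis: "string_basis L t z p" and gen: "linear_forms_gen L M"
    and z: "\<And>k. k < t \<Longrightarrow> z k \<in> forms (e k)"
  shows "inj_on e {..<t}"
proof (rule inj_onI, rule ccontr)
  fix k k' assume k: "k \<in> {..<t}" "k' \<in> {..<t}" "e k = e k'" "k \<noteq> k'"
  obtain c w where c: "z k - (const_poly c * M ^ e k + L * w) \<in> I"
    using form_eq_power_plus_multiple[OF gen z, of k] k by auto
  obtain c' w' where c': "z k' - (const_poly c' * M ^ e k + L * w') \<in> I"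
    using form_eq_power_plus_multiple[OF gen z, of k'] k by auto
  obtain \<alpha> \<beta> where ab: "\<alpha> * c + \<beta> * c' = 0" "\<alpha> \<noteq> 0 \<or> \<beta> \<noteq> 0"
  proof (cases "c' = 0")
    case True
    then show ?thesis using that[of 0 1] by simp
  next
    case False
    then show ?thesis using that[of c' "- c"] by simp
  qed
  define r where "r x = (if x = (k, 0) then \<alpha> else \<beta>)" for x :: "nat \<times> nat"
  let ?b = "\<lambda>(k, j). L ^ j * z k" and ?Z = "{(k, 0), (k', 0)} :: (nat \<times> nat) set"
  let ?Y = "SIGMA k:{..<t}. {1..<p k}"
  have "lincomb ?b ?Z r = const_poly \<alpha> * z k + const_poly \<beta> * z k'"
    using k by (simp add: lincomb_def r_def)
  moreover have "const_poly \<alpha> * (z k - (const_poly c * M ^ e k + L * w))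
      + const_poly \<beta> * (z k' - (const_poly c' * M ^ e k + L * w')) \<in> I"
    by (intro add_mem mult_mem c c')
  moreover have "const_poly \<alpha> * (z k - (const_poly c * M ^ e k + L * w))
      + const_poly \<beta> * (z k' - (const_poly c' * M ^ e k + L * w'))
    = const_poly \<alpha> * z k + const_poly \<beta> * z k' - const_poly (\<alpha> * c + \<beta> * c') * M ^ e k
      - L * (const_poly \<alpha> * w + const_poly \<beta> * w')"
    by (simp add: const_poly_add const_poly_mult algebra_simps)
  ultimately have "lincomb ?b ?Z r - L ^ 1 * (const_poly \<alpha> * w + const_poly \<beta> * w') \<in> I"
    by (simp add: ab(1))
  then have span: "lincomb ?b ?Z r \<in> span_mod ?b ?Y"
    using power_mult_in_span_tails[OF basis] span_mod_cong by blast
  have r0: "r x = 0" if "x \<in> ?Z" for x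
    using string_basisD(3)[OF basis] _ _ _ _ span that
    by (rule indep_mod_disjoint_span) (use k string_basisD(1)[OF basis] in auto)
  then show False using r0[of "(k, 0)"] r0[of "(k', 0)"] ab(2) k by (auto simp: r_def)
qed

end

locale homogeneous_poly_ideal = poly_ideal I
  for I :: "('n::finite, 'k::field_char_0) mpoly set" +
  assumes hom_part_mem: "f \<in> I \<Longrightarrow> hom_part i f \<in> I"
begin

lemma form_in_span_same_degree:
  assumes b: "\<And>x. x \<in> X \<Longrightarrow> b x \<in> forms (dg x)" and "finite X"
    and "f \<in> forms i" "f \<in> span_mod b X"
  shows "f \<in> span_mod b {x \<in> X. dg x = i}"
proof -
  obtain c where c: "f - lincomb b X c \<in> I" using assms(4) by (auto simp: span_mod_def)
  have "hom_part i (lincomb b X c) = lincomb b {x \<in> X. dg x = i} c"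
    unfolding lincomb_def hom_part_sum
    by (rule sum.mono_neutral_cong_right)
      (use assms(2) b in \<open>auto simp: hom_part_form[OF forms_const_mult[OF b]]\<close>)
  then have "f - lincomb b {x \<in> X. dg x = i} c \<in> I"
    using hom_part_mem[OF c, of i] assms(3) by (simp add: hom_part_diff hom_part_form)
  then show ?thesis by (auto simp: span_mod_def)
qed

text \<open>
  Write \<open>p k = q + 1\<close> and \<open>e k = i + 1\<close>. If no string of length at least \<open>p k\<close> started in degree \<open>i\<close>,
  every form of degree \<open>i\<close> would be the sum of a multiple of \<open>L\<close> and of generators killed by \<open>L ^ q\<close>,
  so \<open>L ^ q * M ^ i\<close> would be a multiple of \<open>L ^ (q + 1)\<close>. Since \<open>z k\<close> is a multiple of \<open>M ^ (i + 1)\<close>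
  modulo \<open>L\<close>, the last element \<open>L ^ q * z k\<close> of its string would be a multiple of \<open>L ^ (q + 1)\<close> as
  well, which the independence of the strings excludes.
\<close>

lemma string_predecessor:
  assumes basis: "string_basis L t z p" and gen: "linear_forms_gen L M"
    and L: "L \<in> forms 1" and M: "M \<in> forms 1"
    and z: "\<And>k. k < t \<Longrightarrow> z k \<in> forms (e k)"
    and k: "k < t" "0 < e k"
  shows "\<exists>k'<t. Suc (e k') = e k \<and> p k \<le> p k'"
proof (rule ccontr)
  assume contr: "\<not> ?thesis"
  obtain i where i: "e k = Suc i" using k(2) by (cases "e k") auto
  obtain q where q: "p k = Suc q" using string_basisD(1)[OF basis k(1)] by (cases "p k") auto
  let ?b = "\<lambda>(k, j). L ^ j * z k" and ?X = "SIGMA k:{..<t}. {..<p k}"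
  let ?Y = "SIGMA k:{..<t}. {Suc q..<p k}"
  have tail: "L ^ Suc q * f \<in> span_mod ?b ?Y" for f by (rule power_mult_in_span_tails[OF basis])
  have "M ^ i \<in> span_mod ?b {x \<in> ?X. e (fst x) + snd x = i}"
    using string_basisD(4)[OF basis, of "M ^ i"]
    by (intro form_in_span_same_degree)
      (auto simp: add.commute intro!: forms_mult forms_power z L M)
  then have "L ^ q * M ^ i \<in> span_mod ?b ?Y"
  proof (rule span_mod_mult)
    fix x assume "x \<in> {x \<in> ?X. e (fst x) + snd x = i}"
    then obtain k' j where x: "x = (k', j)" "k' < t" "j < p k'" "e k' + j = i" by auto
    show "L ^ q * ?b x \<in> span_mod ?b ?Y"
    proof (cases j)
      case 0
      then have "p k' \<le> q" using contr x i q by auto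
      then have "L ^ q * z k' \<in> I" using string_basisD(2)[OF basis] x by simp
      then show ?thesis using x 0 by (simp add: span_mod_ideal)
    next
      case (Suc j')
      then show ?thesis using tail[of "L ^ j' * z k'"] x by (simp add: mult_ac)
    qed
  qed
  then have "M * (L ^ q * M ^ i) \<in> span_mod ?b ?Y"
  proof (rule span_mod_mult)
    fix x assume "x \<in> ?Y"
    then obtain k' j where x: "x = (k', j)" "Suc q \<le> j" by auto
    then have "L ^ j = L ^ Suc q * L ^ (j - Suc q)" by (simp flip: power_add del: power_Suc)
    then have "M * ?b x = M * (L ^ Suc q * L ^ (j - Suc q) * z k')"
      by (simp only: x prod.case)
    also have "\<dots> = L ^ Suc q * (M * L ^ (j - Suc q) * z k')"
      by (simp only: mult_ac)
    finally have "M * ?b x = L ^ Suc q * (M * L ^ (j - Suc q) * z k')" .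
    then show "M * ?b x \<in> span_mod ?b ?Y" using tail by simp
  qed
  then have power: "L ^ q * M ^ e k \<in> span_mod ?b ?Y" by (simp add: i mult.left_commute)
  obtain c w where c: "z k - (const_poly c * M ^ e k + L * w) \<in> I"
    using form_eq_power_plus_multiple[OF gen z[OF k(1)]] by blast
  from mult_mem[OF this, of "L ^ q"]
  have "L ^ q * z k - (const_poly c * (L ^ q * M ^ e k) + L ^ Suc q * w) \<in> I"
    by (simp add: algebra_simps)
  then have "?b (k, q) \<in> span_mod ?b ?Y"
    using span_mod_cong[OF span_mod_add[OF span_mod_scale[OF power] tail]] by simp
  moreover have "?b (k, q) \<notin> span_mod ?b ?Y"
    using string_basisD(3)[OF basis]
    by (rule indep_mod_not_in_span) (use k q in auto)
  ultimately show False by blast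
qed

lemma string_degree_count:
  assumes basis: "string_basis L t z p" and gen: "linear_forms_gen L M"
    and L: "L \<in> forms 1" and M: "M \<in> forms 1"
    and z: "\<And>k. k < t \<Longrightarrow> z k \<in> forms (e k)"
  defines "n \<equiv> \<lambda>q. size {#r \<in># image_mset p (mset_set {..<t}). q \<le> r#}"
  shows "count (image_mset (\<lambda>k. (p k, e k)) (mset_set {..<t})) (q, i)
    = (if i < n q \<and> \<not> i < n (Suc q) then 1 else 0)"
  unfolding n_def
  using string_degrees_distinct[OF basis gen z] string_predecessor[OF basis gen L M z]
  by (intro staircase_count) auto

section \<open>Hilbert functions in codimension two\<close>

text \<open>
  With respect to such a basis the Hilbert function at \<open>i\<close> is the number of basis elements of degree
  \<open>i\<close>, and it appears below in this form.
\<close>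

definition homogeneous_basis :: "('x \<Rightarrow> ('n, 'k) mpoly) \<Rightarrow> 'x set \<Rightarrow> ('x \<Rightarrow> nat) \<Rightarrow> bool" where
  "homogeneous_basis b X dg \<longleftrightarrow> finite X \<and> indep_mod b X \<and> span_mod b X = UNIV \<and>
     (\<forall>x\<in>X. b x \<in> forms (dg x))"

lemma homogeneous_basisD:
  assumes "homogeneous_basis b X dg"
  shows "finite X" "indep_mod b {x \<in> X. dg x = i}"
    "f \<in> forms i \<Longrightarrow> f \<in> span_mod b {x \<in> X. dg x = i}"
    "x \<in> X \<Longrightarrow> b x \<in> forms (dg x)"
  using assms form_in_span_same_degree[of X b dg f i]
  by (auto simp: homogeneous_basis_def intro: indep_mod_subset)

lemma hilbert_le_Suc:
  assumes "homogeneous_basis b X dg" and gen: "linear_forms_gen U V"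
  shows "card {x \<in> X. dg x = i} \<le> Suc i"
proof -
  have "card {x \<in> X. dg x = i} \<le> card {..i}"
    by (rule card_le_if_indep_mod_span_mod[of _ _ b "\<lambda>a. U ^ a * V ^ (i - a)"])
      (use homogeneous_basisD[OF assms(1)] form_in_span_monomials[OF gen] in auto)
  then show ?thesis by simp
qed

text \<open>
  Macaulay's bound for two variables. Let \<open>E i\<close> be the set of exponents \<open>a\<close> for which
  \<open>U ^ a * V ^ (i - a)\<close> is independent of the monomials with smaller exponents; it has as many elements
  as a basis in degree \<open>i\<close>. If \<open>a \<le> i\<close> is missing from \<open>E i\<close>, multiplication by \<open>V\<close> and by \<open>U\<close> shows that
  \<open>a\<close> and \<open>a + 1\<close> are missing from \<open>E (i + 1)\<close>. As \<open>h i \<le> i\<close>, some \<open>a0 \<le> i\<close> is missing, and lowering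
  the exponents above \<open>a0\<close> by one embeds \<open>E (i + 1)\<close> into \<open>E i\<close>.
\<close>

lemma hilbert_nonincreasing:
  assumes basis: "homogeneous_basis b X dg" and gen: "linear_forms_gen U V"
    and U: "U \<in> forms 1" and V: "V \<in> forms 1"
    and le: "card {x \<in> X. dg x = i} \<le> i"
  shows "card {x \<in> X. dg x = Suc i} \<le> card {x \<in> X. dg x = i}"
proof -
  define u where "u i a = U ^ a * V ^ (i - a)" for i a
  define E where "E i = {a. a < Suc i \<and> u i a \<notin> span_mod (u i) {..<a}}" for i
  have E: "indep_mod (u i) (E i)" "\<And>a. a \<le> i \<Longrightarrow> u i a \<in> span_mod (u i) (E i)" for i
    using greedy_basis[where u = "u i" and n = "Suc i"] by (auto simp: E_def)
  have fin: "finite (E i)" for i by (simp add: E_def)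
  have u: "u i a \<in> forms i" if "a \<le> i" for i a
    using forms_mult[OF forms_power[OF U, of a] forms_power[OF V, of "i - a"]] that
    by (simp add: u_def)
  have card: "card {x \<in> X. dg x = i} = card (E i)" for i
  proof (rule antisym)
    show "card {x \<in> X. dg x = i} \<le> card (E i)"
    proof (rule card_le_if_indep_mod_span_mod)
      fix x assume "x \<in> {x \<in> X. dg x = i}"
      then have "b x \<in> span_mod (u i) {..i}"
        using homogeneous_basisD(4)[OF basis] form_in_span_monomials[OF gen]
        unfolding u_def[abs_def] by auto
      then show "b x \<in> span_mod (u i) (E i)" by (rule span_mod_trans) (use E in auto)
    qed (use homogeneous_basisD[OF basis] fin in auto)
    show "card (E i) \<le> card {x \<in> X. dg x = i}"
    proof (rule card_le_if_indep_mod_span_mod)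
      fix a assume "a \<in> E i"
      then have "u i a \<in> forms i" by (intro u) (simp add: E_def)
      then show "u i a \<in> span_mod b {x \<in> X. dg x = i}" by (rule homogeneous_basisD(3)[OF basis])
    qed (use E(1) fin homogeneous_basisD(1)[OF basis] in auto)
  qed
  have left: "a \<in> E i" if "a \<in> E (Suc i)" "a \<le> i" for a
  proof (rule ccontr)
    assume "a \<notin> E i"
    then have "u i a \<in> span_mod (u i) {..<a}" using that by (simp add: E_def)
    then have "V * u i a \<in> span_mod (u (Suc i)) {..<a}"
    proof (rule span_mod_mult)
      fix c assume "c \<in> {..<a}"
      moreover from this have "V * u i c = u (Suc i) c"
        using that(2) by (simp add: u_def Suc_diff_le mult.left_commute)
      ultimately show "V * u i c \<in> span_mod (u (Suc i)) {..<a}" by (simp add: span_mod_base)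
    qed
    moreover have "V * u i a = u (Suc i) a"
      using that(2) by (simp add: u_def Suc_diff_le mult.left_commute)
    ultimately show False using that(1) by (simp add: E_def)
  qed
  have right: "a \<in> E i" if "Suc a \<in> E (Suc i)" for a
  proof (rule ccontr)
    have Uu: "U * u i c = u (Suc i) (Suc c)" for c by (simp add: u_def mult.assoc)
    assume "a \<notin> E i"
    then have "u i a \<in> span_mod (u i) {..<a}" using that by (simp add: E_def)
    then have "U * u i a \<in> span_mod (u (Suc i)) {..<Suc a}"
      by (rule span_mod_mult) (simp add: Uu span_mod_base)
    then show False using that by (simp add: E_def Uu)
  qed
  have "E i \<subseteq> {..i}" by (auto simp: E_def)
  moreover have "E i \<noteq> {..i}" using le card[of i] by auto
  ultimately obtain a0 where a0: "a0 \<le> i" "a0 \<notin> E i" by auto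
  have "card (E (Suc i)) \<le> card (E i)"
  proof (rule card_inj_on_le)
    let ?g = "\<lambda>a. if a < a0 then a else a - 1"
    have cases: "a < a0 \<or> Suc a0 < a" if "a \<in> E (Suc i)" for a
      using left[of a] right[of a0] that a0 by (cases "a = a0 \<or> a = Suc a0") auto
    show "inj_on ?g (E (Suc i))"
    proof (rule inj_onI)
      fix a c assume "a \<in> E (Suc i)" "c \<in> E (Suc i)" and eq: "?g a = ?g c"
      then show "a = c" using cases[of a] cases[of c] by (auto split: if_splits)
    qed
    show "?g ` E (Suc i) \<subseteq> E i"
    proof safe
      fix a assume a: "a \<in> E (Suc i)"
      show "?g a \<in> E i" using cases[OF a] left[of a] right[of "a - 1"] a a0 by auto
    qed
  qed (rule fin)
  then show ?thesis by (simp add: card)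
qed

end

section \<open>Apolarity and the symmetry of the Hilbert function\<close>

definition exponent_fact :: "('n::finite \<Rightarrow>\<^sub>0 nat) \<Rightarrow> 'k::field_char_0" where
  "exponent_fact m = (\<Prod>i\<in>UNIV. fact (Poly_Mapping.lookup m i))"

lemma exponent_fact_nonzero [simp]: "exponent_fact m \<noteq> 0"
  by (simp add: exponent_fact_def)

lemma diff_coeff_mult_exponent_fact:
  "diff_coeff m (m + w) * exponent_fact w = (exponent_fact (m + w) :: 'k::field_char_0)"
proof -
  have "(\<Prod>j<a. of_nat (a + b) - of_nat j) * fact b = (fact (a + b) :: 'k)" for a b :: nat
  proof (induction a)
    case (Suc a)
    have "(\<Prod>j<Suc a. of_nat (Suc a + b) - of_nat j) * (fact b :: 'k)
        = of_nat (Suc a + b) * ((\<Prod>j<a. of_nat (a + b) - of_nat j) * fact b)"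
      by (subst prod.lessThan_Suc_shift) (simp add: mult.assoc)
    also have "\<dots> = of_nat (Suc a + b) * fact (a + b)" by (simp only: Suc.IH)
    also have "\<dots> = fact (Suc a + b)" by simp
    finally show ?case .
  qed simp
  then show ?thesis
    by (simp add: diff_coeff_def exponent_fact_def lookup_add flip: prod.distrib)
qed

lemma diff_coeff_nonzero_imp_le:
  assumes "diff_coeff m u \<noteq> (0 :: 'k::field_char_0)"
  shows "m + (u - m) = u"
proof (rule poly_mapping_eqI)
  fix i
  have "(\<Prod>j<Poly_Mapping.lookup m i. of_nat (Poly_Mapping.lookup u i) - of_nat j) \<noteq> (0 :: 'k)"
    using assms by (simp add: diff_coeff_def)
  then have "\<forall>j<Poly_Mapping.lookup m i. Poly_Mapping.lookup u i \<noteq> j" by auto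
  then have "\<not> Poly_Mapping.lookup u i < Poly_Mapping.lookup m i" by blast
  then show "Poly_Mapping.lookup (m + (u - m)) i = Poly_Mapping.lookup u i"
    by (simp add: lookup_add lookup_minus)
qed

text \<open>
  The constant coefficient of \<open>diff_act g F\<close>: differentiating \<open>X^u\<close> by \<open>x^m\<close> leaves a nonzero constant
  only for \<open>m = u\<close>, and this constant is the product of the factorials of the exponents.
\<close>

definition apolar_pairing ::
  "('n::finite, 'k::field_char_0) mpoly \<Rightarrow> ('n, 'k) mpoly \<Rightarrow> 'k" where
  "apolar_pairing F g =
     (\<Sum>u\<in>Poly_Mapping.keys F. Poly_Mapping.lookup g u * Poly_Mapping.lookup F u * exponent_fact u)"

lemma apolar_pairing_diff: "apolar_pairing F (f - g) = apolar_pairing F f - apolar_pairing F g"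
  by (simp add: apolar_pairing_def lookup_minus left_diff_distrib sum_subtractf)

lemma apolar_pairing_const_mult: "apolar_pairing F (const_poly c * g) = c * apolar_pairing F g"
  by (simp add: apolar_pairing_def lookup_const_poly_mult sum_distrib_left mult.assoc)

lemma apolar_pairing_sum: "apolar_pairing F (\<Sum>x\<in>X. f x) = (\<Sum>x\<in>X. apolar_pairing F (f x))"
  unfolding apolar_pairing_def lookup_sum sum_distrib_right by (rule sum.swap)

lemma apolar_pairing_other_degree:
  assumes "F \<in> forms d" "g \<in> forms i" "i \<noteq> d"
  shows "apolar_pairing F g = 0"
  unfolding apolar_pairing_def
  by (rule sum.neutral) (use assms in \<open>auto simp: forms_def in_keys_iff\<close>)

text \<open>
  Differentiating once more by \<open>x^w\<close> turns the coefficient at \<open>X^w\<close> into the constant coefficient,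
  up to the nonzero factor \<open>exponent_fact w\<close>. Via this identity membership in the
  annihilator is expressed by the linear functional \<open>apolar_pairing F\<close> alone.
\<close>

lemma lookup_diff_act:
  fixes g F :: "('n::finite, 'k::field_char_0) mpoly"
  shows "Poly_Mapping.lookup (diff_act g F) w * exponent_fact w
     = apolar_pairing F (g * Poly_Mapping.single w 1)"
proof -
  let ?G = "Poly_Mapping.lookup g" and ?F = "Poly_Mapping.lookup F"
  have shift: "Poly_Mapping.lookup (g * Poly_Mapping.single w 1) u
      = (\<Sum>m\<in>Poly_Mapping.keys g. if m + w = u then ?G m else 0)" for u
  proof -
    have "g * Poly_Mapping.single w 1 = (\<Sum>m\<in>Poly_Mapping.keys g. Poly_Mapping.single (m + w) (?G m))"
      by (subst sum_monomials[of g])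
        (simp add: sum_distrib_right const_poly_mult_single mult_single)
    then show ?thesis by (simp add: lookup_sum lookup_single when_def)
  qed
  have summand: "(if u - m = w then ?G m * ?F u * diff_coeff m u else 0) * exponent_fact w
      = (if m + w = u then ?G m else 0) * ?F u * exponent_fact u" for m u
  proof (cases "m + w = u")
    case True
    then have "u - m = w" by auto
    then show ?thesis
      using True diff_coeff_mult_exponent_fact[of m w, where ?'k = 'k] by (auto simp: mult.assoc)
  next
    case False
    then have "u - m = w \<Longrightarrow> diff_coeff m u = (0 :: 'k)"
      using diff_coeff_nonzero_imp_le[of m u, where ?'k = 'k] by auto
    then show ?thesis using False by simp
  qed
  have "Poly_Mapping.lookup (diff_act g F) w * exponent_fact w
      = (\<Sum>m\<in>Poly_Mapping.keys g. \<Sum>u\<in>Poly_Mapping.keys F.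
          (if u - m = w then ?G m * ?F u * diff_coeff m u else 0) * exponent_fact w)"
    by (simp add: diff_act_def lookup_sum lookup_single when_def sum_distrib_right)
  also have "\<dots> = (\<Sum>u\<in>Poly_Mapping.keys F. \<Sum>m\<in>Poly_Mapping.keys g.
          (if m + w = u then ?G m else 0) * ?F u * exponent_fact u)"
    by (subst sum.swap) (simp only: summand)
  also have "\<dots> = apolar_pairing F (g * Poly_Mapping.single w 1)"
    by (simp add: apolar_pairing_def shift sum_distrib_right)
  finally show ?thesis .
qed

lemma annihilator_iff_apolar_pairing:
  "g \<in> annihilator F \<longleftrightarrow> (\<forall>w. apolar_pairing F (g * Poly_Mapping.single w 1) = 0)"
proof -
  have "diff_act g F = 0 \<longleftrightarrow> (\<forall>w. Poly_Mapping.lookup (diff_act g F) w * exponent_fact w = 0)"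
    by (simp add: poly_mapping_eq_iff fun_eq_iff)
  then show ?thesis by (simp only: annihilator_def mem_Collect_eq lookup_diff_act)
qed

context homogeneous_poly_ideal begin

lemma form_above_socle_degree_mem:
  assumes "F \<in> forms d" "I = annihilator F" "g \<in> forms i" "d < i"
  shows "g \<in> I"
proof -
  have "g * Poly_Mapping.single w 1 \<in> forms (i + monom_deg w)" for w
    by (intro forms_mult assms forms_single) simp
  then have "apolar_pairing F (g * Poly_Mapping.single w 1) = 0" for w
    by (rule apolar_pairing_other_degree[OF assms(1)]) (use assms(4) in simp)
  then show ?thesis using assms(2) by (simp add: annihilator_iff_apolar_pairing)
qed

text \<open>
  The pairing of degrees \<open>i\<close> and \<open>d - i\<close> by \<open>apolar_pairing F (f * g)\<close> is nondegenerate. If degree \<open>i\<close>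
  had the larger dimension, some nontrivial combination \<open>g\<close> of its basis would be orthogonal to degree
  \<open>d - i\<close>. For reasons of degree \<open>g\<close> is orthogonal to all other monomials too, and so lies in the
  annihilator of \<open>F\<close>.
\<close>

lemma hilbert_le_dual:
  assumes F: "F \<in> forms d" and I: "I = annihilator F"
    and basis: "homogeneous_basis b X dg" and i: "i \<le> d"
  shows "card {x \<in> X. dg x = i} \<le> card {x \<in> X. dg x = d - i}"
proof (rule ccontr)
  assume less: "\<not> card {x \<in> X. dg x = i} \<le> card {x \<in> X. dg x = d - i}"
  let ?X = "\<lambda>i. {x \<in> X. dg x = i}"
  have fin: "finite (?X i)" for i using homogeneous_basisD(1)[OF basis] by simp
  obtain c where nz: "\<exists>x\<in>?X i. c x \<noteq> 0"
    and c: "\<And>y. y \<in> ?X (d - i) \<Longrightarrow> (\<Sum>x\<in>?X i. c x * apolar_pairing F (b x * b y)) = 0"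
    using homogeneous_system_nontrivial_solution[OF fin fin, of "d - i" i "\<lambda>x y. apolar_pairing F (b x * b y)"] less
    by auto
  define g where "g = lincomb b (?X i) c"
  have g: "g \<in> forms i"
    unfolding g_def lincomb_def using homogeneous_basisD(4)[OF basis]
    by (intro forms_sum forms_const_mult) auto
  have perp: "apolar_pairing F (g * b y) = 0" if "y \<in> ?X (d - i)" for y
    using c[OF that]
    by (simp add: g_def lincomb_def sum_distrib_right apolar_pairing_sum mult.assoc
        apolar_pairing_const_mult)
  have "apolar_pairing F (g * Poly_Mapping.single w 1) = 0" for w
  proof (cases "monom_deg w = d - i")
    case False
    have "g * Poly_Mapping.single w 1 \<in> forms (i + monom_deg w)"
      by (intro forms_mult g forms_single) simp
    then show ?thesis by (rule apolar_pairing_other_degree[OF F]) (use False i in auto)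
  next
    case True
    let ?w = "Poly_Mapping.single w 1 :: ('n, 'k) mpoly"
    have "?w \<in> span_mod b (?X (d - i))"
      using homogeneous_basisD(3)[OF basis forms_single[OF True]] .
    then obtain r where r: "?w - lincomb b (?X (d - i)) r \<in> I" by (auto simp: span_mod_def)
    have "g * (?w - lincomb b (?X (d - i)) r) \<in> annihilator F" using mult_mem[OF r, of g] I by simp
    then have "apolar_pairing F (g * (?w - lincomb b (?X (d - i)) r) * Poly_Mapping.single 0 1) = 0"
      unfolding annihilator_iff_apolar_pairing by (rule spec)
    then have "apolar_pairing F (g * ?w) = apolar_pairing F (g * lincomb b (?X (d - i)) r)"
      by (simp add: right_diff_distrib apolar_pairing_diff)
    also have "\<dots> = (\<Sum>y\<in>?X (d - i). r y * apolar_pairing F (g * b y))"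
      by (simp add: lincomb_def sum_distrib_left apolar_pairing_sum mult.left_commute[of g]
          apolar_pairing_const_mult)
    also have "\<dots> = 0" using perp by simp
    finally show ?thesis .
  qed
  then have "g \<in> I" by (simp add: I annihilator_iff_apolar_pairing)
  then have "c x = 0" if "x \<in> ?X i" for x
    using indep_modD[OF homogeneous_basisD(2)[OF basis]] that unfolding g_def by blast
  then show False using nz by blast
qed

lemma hilbert_symmetric:
  assumes "F \<in> forms d" "I = annihilator F" "homogeneous_basis b X dg" "i \<le> d"
  shows "card {x \<in> X. dg x = i} = card {x \<in> X. dg x = d - i}"
  using hilbert_le_dual[OF assms] hilbert_le_dual[OF assms(1-3), of "d - i"] assms(4) by simp

lemma hilbert_zero_above_socle_degree:
  assumes "F \<in> forms d" "I = annihilator F" "homogeneous_basis b X dg" "d < i"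
  shows "card {x \<in> X. dg x = i} = 0"
proof -
  have "b x \<notin> I" if "x \<in> X" for x
  proof -
    have "b x \<notin> span_mod b {}"
      using assms(3) that by (intro indep_mod_not_in_span[of b X]) (auto simp: homogeneous_basis_def)
    then show ?thesis using span_mod_ideal by blast
  qed
  moreover have "b x \<in> I" if "x \<in> X" "dg x = i" for x
    using form_above_socle_degree_mem[OF assms(1,2) _ assms(4)] homogeneous_basisD(4)[OF assms(3)] that
    by blast
  ultimately have "{x \<in> X. dg x = i} = {}" by blast
  then show ?thesis by (simp only: card.empty)
qed

end

section \<open>From the quotient ring to polynomials modulo the ideal\<close>

lemma ex_map_distinct:
  assumes "distinct xs" "length ys = length xs"
  obtains g where "ys = map g xs"
proof -
  have "\<exists>g. ys = map g xs"
    using assms(2,1)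
  proof (induction ys xs rule: list_induct2)
    case (Cons y ys x xs)
    then obtain g where "ys = map g xs" by auto
    then show ?case using Cons.prems by (intro exI[of _ "g(x := y)"]) auto
  qed simp
  then show ?thesis using that by blast
qed

lemma a_inv_poly_ring: "\<ominus>\<^bsub>poly_ring\<^esub> f = - f"
proof -
  interpret R: cring "poly_ring :: ('a, 'b) mpoly ring" by (rule cring_poly_ring)
  show ?thesis by (rule R.minus_equality) auto
qed

lemma subfield_constants:
  "subfield (range const_poly) (poly_ring :: ('n::finite, 'k::field_char_0) mpoly ring)"
proof -
  interpret R: cring "poly_ring :: ('n, 'k) mpoly ring" by (rule cring_poly_ring)
  have range_intro: "f \<in> range const_poly" if "f = const_poly c" for f :: "('n, 'k) mpoly" and c
    using that by simp
  show ?thesis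
  proof (rule R.subfieldI)
    show "subcring (range const_poly) (poly_ring :: ('n, 'k) mpoly ring)"
    proof (intro R.subcringI' R.subringI)
      show "\<one>\<^bsub>poly_ring\<^esub> \<in> range (const_poly :: 'k \<Rightarrow> ('n, 'k) mpoly)"
        by (rule range_intro[of _ 1]) simp
      fix f g :: "('n, 'k) mpoly"
      assume "f \<in> range const_poly" "g \<in> range const_poly"
      then obtain a b where ab: "f = const_poly a" "g = const_poly b" by blast
      show "\<ominus>\<^bsub>poly_ring\<^esub> f \<in> range const_poly"
        by (rule range_intro[of _ "- a"]) (simp add: ab a_inv_poly_ring const_poly_uminus)
      show "f \<otimes>\<^bsub>poly_ring\<^esub> g \<in> range const_poly"
        by (rule range_intro[of _ "a * b"]) (simp add: ab const_poly_mult)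
      show "f \<oplus>\<^bsub>poly_ring\<^esub> g \<in> range const_poly"
        by (rule range_intro[of _ "a + b"]) (simp add: ab const_poly_add)
    qed simp
    show "Units (poly_ring\<lparr>carrier := range const_poly\<rparr>)
        = range const_poly - {\<zero>\<^bsub>poly_ring :: ('n, 'k) mpoly ring\<^esub>}"
    proof (intro equalityI subsetI)
      fix f assume f: "f \<in> range const_poly - {\<zero>\<^bsub>poly_ring :: ('n, 'k) mpoly ring\<^esub>}"
      then obtain c where c: "f = const_poly c" "f \<noteq> 0" by auto
      then have "c \<noteq> 0" by auto
      then have "const_poly (inverse c) * f = 1" "f * const_poly (inverse c) = 1"
        by (simp_all add: c(1) flip: const_poly_mult)
      then show "f \<in> Units (poly_ring\<lparr>carrier := range const_poly\<rparr>)"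
        using f c by (auto simp: Units_def intro!: bexI[of _ "const_poly (inverse c)"])
    next
      fix f assume f: "f \<in> Units (poly_ring\<lparr>carrier := range (const_poly :: 'k \<Rightarrow> ('n, 'k) mpoly)\<rparr>)"
      then obtain g where "g * f = 1" by (auto simp: Units_def)
      then have "f \<noteq> 0" by auto
      then show "f \<in> range const_poly - {\<zero>\<^bsub>poly_ring :: ('n, 'k) mpoly ring\<^esub>}"
        using f by (simp add: Units_def)
    qed
  qed
qed

lemma subalgebra_forms:
  "subalgebra (range const_poly) (forms i) (poly_ring :: ('n::finite, 'k::field_char_0) mpoly ring)"
proof -
  interpret R: cring "poly_ring :: ('n, 'k) mpoly ring" by (rule cring_poly_ring)
  have "- f \<in> forms i" if "f \<in> forms i" for f :: "('n, 'k) mpoly"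
    using forms_const_mult[OF that, of "- 1"] by (simp add: const_poly_uminus)
  then have "subgroup (forms i) (add_monoid (poly_ring :: ('n, 'k) mpoly ring))"
    using forms_add[of _ i] ex_in_conv[of "forms i", THEN iffD1, OF exI, OF forms_zero]
    by (intro R.add.subgroupI) (auto simp flip: a_inv_def simp: a_inv_poly_ring)
  then show ?thesis
    by (intro subalgebra.intro subalgebra_axioms.intro) (auto intro: forms_const_mult)
qed

context poly_ideal begin

abbreviation residue :: "('n, 'k) mpoly \<Rightarrow> ('n, 'k) mpoly set" where
  "residue f \<equiv> I +>\<^bsub>poly_ring\<^esub> f"

lemma residue_hom: "ring_hom_ring poly_ring (quot_alg I) residue"
  by (rule ideal.rcos_ring_hom_ring[OF ideal])

lemma carrier_quot: "carrier (quot_alg I) = range residue"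
  by (auto simp: FactRing_def A_RCOSETS_def')

lemma residue_simps:
  "residue f \<otimes>\<^bsub>quot_alg I\<^esub> residue g = residue (f * g)"
  "residue f \<oplus>\<^bsub>quot_alg I\<^esub> residue g = residue (f + g)"
  "\<one>\<^bsub>quot_alg I\<^esub> = residue 1"
  "residue f [^]\<^bsub>quot_alg I\<^esub> (i :: nat) = residue (f ^ i)"
proof -
  interpret h: ring_hom_ring poly_ring "quot_alg I" residue by (rule residue_hom)
  show mult: "residue f \<otimes>\<^bsub>quot_alg I\<^esub> residue g = residue (f * g)" for f g
    using h.hom_mult[of f g] by simp
  show "residue f \<oplus>\<^bsub>quot_alg I\<^esub> residue g = residue (f + g)"
    using h.hom_add[of f g] by simp
  show one: "\<one>\<^bsub>quot_alg I\<^esub> = residue 1" using h.hom_one by simp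
  show "residue f [^]\<^bsub>quot_alg I\<^esub> i = residue (f ^ i)"
    by (induction i) (simp_all add: one mult mult.commute)
qed

lemma residue_eq_iff: "residue f = residue g \<longleftrightarrow> f - g \<in> I"
proof
  have mem: "x \<in> residue y \<longleftrightarrow> x - y \<in> I" for x y
  proof -
    have "x \<in> residue y \<longleftrightarrow> (\<exists>h\<in>I. x = h + y)" by (auto simp: a_r_coset_def')
    then show ?thesis by (metis add_diff_cancel diff_add_cancel)
  qed
  show "f - g \<in> I" if "residue f = residue g" using mem[of f f] mem[of f g] that by simp
  show "residue f = residue g" if "f - g \<in> I"
  proof (rule Set.set_eqI)
    fix x
    have "x - g = (x - f) + (f - g)" "x - f = (x - g) - (f - g)" by simp_all
    then show "x \<in> residue f \<longleftrightarrow> x \<in> residue g"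
      unfolding mem using add_mem[OF _ that] diff_mem[OF _ that] by metis
  qed
qed

lemma residue_eq_zero_iff: "residue f = \<zero>\<^bsub>quot_alg I\<^esub> \<longleftrightarrow> f \<in> I"
proof -
  interpret h: ring_hom_ring poly_ring "quot_alg I" residue by (rule residue_hom)
  have "residue 0 = \<zero>\<^bsub>quot_alg I\<^esub>" using h.hom_zero by simp
  then show ?thesis using residue_eq_iff[of f 0] by simp
qed

lemma scalars_eq: "scalars I = residue ` range const_poly"
  by (simp add: scalars_def image_image)

text \<open>
  A proper ideal is needed here: in the zero ring the image of the constants is not a field.
\<close>

lemma subfield_scalars: "1 \<notin> I \<Longrightarrow> subfield (scalars I) (quot_alg I)"
  unfolding scalars_eq
  by (rule ring_hom_ring.img_is_subfield(2)[OF residue_hom subfield_constants])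
    (simp add: residue_simps residue_eq_zero_iff)

lemma combine_residue:
  "ring.combine (quot_alg I) (map (\<lambda>x. residue (const_poly (c x))) xs) (map (\<lambda>x. residue (b x)) xs)
     = residue (\<Sum>x\<leftarrow>xs. const_poly (c x) * b x)"
proof -
  interpret Q: ring "quot_alg I" by (rule ideal.quotient_is_ring[OF ideal])
  show ?thesis
    by (induction xs) (simp_all add: residue_simps residue_eq_zero_iff[THEN iffD2])
qed

lemma indep_mod_if_independent:
  assumes "1 \<notin> I" "distinct xs"
    and "ring.independent (quot_alg I) (scalars I) (map (\<lambda>x. residue (b x)) xs)"
  shows "indep_mod b (set xs)"
  unfolding indep_mod_def
proof (intro allI impI ballI)
  interpret Q: ring "quot_alg I" by (rule ideal.quotient_is_ring[OF ideal])
  fix c x assume c: "lincomb b (set xs) c \<in> I" and x: "x \<in> set xs"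
  let ?Ks = "map (\<lambda>x. residue (const_poly (c x))) xs"
  have "Q.combine ?Ks (map (\<lambda>x. residue (b x)) xs) = \<zero>\<^bsub>quot_alg I\<^esub>"
    unfolding combine_residue residue_eq_zero_iff
    using c assms(2) by (simp add: lincomb_def sum_list_distinct_conv_sum_set)
  then have "set (take (length (map (\<lambda>x. residue (b x)) xs)) ?Ks) \<subseteq> {\<zero>\<^bsub>quot_alg I\<^esub>}"
    by (intro Q.independent_imp_trivial_combine[OF subfield_scalars[OF assms(1)] assms(3)])
      (auto simp: scalars_def)
  then have "residue (const_poly (c x)) = \<zero>\<^bsub>quot_alg I\<^esub>" using x by auto
  then have "const_poly (c x) \<in> I" by (simp only: residue_eq_zero_iff)
  then have 1: "const_poly (inverse (c x)) * const_poly (c x) \<in> I" by (rule mult_mem)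
  show "c x = 0"
  proof (rule ccontr)
    assume "c x \<noteq> 0"
    then show False using 1 assms(1) by (simp flip: const_poly_mult)
  qed
qed

lemma span_mod_if_Span:
  assumes "1 \<notin> I" "distinct xs"
    and "residue f \<in> ring.Span (quot_alg I) (scalars I) (map (\<lambda>x. residue (b x)) xs)"
  shows "f \<in> span_mod b (set xs)"
proof -
  interpret Q: ring "quot_alg I" by (rule ideal.quotient_is_ring[OF ideal])
  let ?Us = "map (\<lambda>x. residue (b x)) xs"
  have "set ?Us \<subseteq> carrier (quot_alg I)" by (auto simp: carrier_quot)
  then obtain Ks where Ks: "set Ks \<subseteq> scalars I" "length Ks = length ?Us" "residue f = Q.combine Ks ?Us"
    using assms(3) Q.Span_eq_combine_set_length_version[OF subfield_scalars[OF assms(1)]] by blast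
  then obtain g where g: "Ks = map g xs"
    using ex_map_distinct[OF assms(2), of Ks] by auto
  have "\<forall>x\<in>set xs. \<exists>c. g x = residue (const_poly c)" using Ks(1) by (auto simp: g scalars_def)
  then obtain c where "\<And>x. x \<in> set xs \<Longrightarrow> g x = residue (const_poly (c x))" by metis
  then have "Ks = map (\<lambda>x. residue (const_poly (c x))) xs" by (simp add: g)
  then have "f - lincomb b (set xs) c \<in> I"
    using Ks(3) assms(2)
    by (simp add: combine_residue residue_eq_iff lincomb_def sum_list_distinct_conv_sum_set)
  then show ?thesis by (auto simp: span_mod_def)
qed

lemma string_basis_if_jordan_decomposition:
  assumes "1 \<notin> I" and dec: "jordan_decomposition I (residue L) zps"
    and z: "\<And>k. k < length zps \<Longrightarrow> fst (zps ! k) = residue (z k)"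
  shows "string_basis L (length zps) z (\<lambda>k. snd (zps ! k))"
proof -
  define t p where "t = length zps" and "p = (\<lambda>k. snd (zps ! k))"
  define xs where "xs = concat (map (\<lambda>k. map (Pair k) [0..<p k]) [0..<t])"
  have set_xs: "set xs = (SIGMA k:{..<t}. {..<p k})" by (auto simp: xs_def)
  have "distinct (concat (map (\<lambda>k. map (Pair k) [0..<p k]) [0..<n]))" for n
    by (induction n) (auto simp: distinct_map inj_on_def)
  then have dist: "distinct xs" by (simp add: xs_def)
  have zps: "zps = map (\<lambda>k. (residue (z k), p k)) [0..<t]"
    by (rule nth_equalityI) (simp_all add: t_def p_def z[symmetric])
  have string: "jordan_string I (residue L) (residue (z k)) n = map (\<lambda>j. residue (L ^ j * z k)) [0..<n]" for k n
    by (simp add: jordan_string_def residue_simps)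
  have bs: "concat (map (\<lambda>(z, p). jordan_string I (residue L) z p) zps)
      = map (\<lambda>x. residue (case x of (k, j) \<Rightarrow> L ^ j * z k)) xs"
    by (simp add: zps string xs_def map_concat o_def)
  have kill: "0 < p k \<and> L ^ p k * z k \<in> I" if "k < t" for k
  proof -
    have "(residue (z k), p k) \<in> set zps" using that by (auto simp: zps)
    then show ?thesis
      using dec by (auto simp: jordan_decomposition_def residue_simps residue_eq_zero_iff)
  qed
  have "ring.independent (quot_alg I) (scalars I) (map (\<lambda>x. residue (case x of (k, j) \<Rightarrow> L ^ j * z k)) xs)"
    and "ring.Span (quot_alg I) (scalars I) (map (\<lambda>x. residue (case x of (k, j) \<Rightarrow> L ^ j * z k)) xs)
      = carrier (quot_alg I)"
    using dec by (auto simp: jordan_decomposition_def bs Let_def)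
  then have "indep_mod (\<lambda>(k, j). L ^ j * z k) (set xs)"
    and "span_mod (\<lambda>(k, j). L ^ j * z k) (set xs) = UNIV"
    using indep_mod_if_independent[OF assms(1) dist] span_mod_if_Span[OF assms(1) dist]
    by (auto simp: carrier_quot)
  then show ?thesis
    using kill by (simp add: string_basis_def set_xs t_def p_def)
qed

text \<open>
  Since \<open>dim\<close> is a unique description and the scalars of the zero ring are not a field, it is checked
  directly that \<open>0\<close> is the only dimension there.
\<close>

lemma one_notin_if_hilbert_fun_pos:
  assumes "0 < hilbert_fun I i"
  shows "1 \<notin> I"
proof
  interpret Q: ring "quot_alg I" by (rule ideal.quotient_is_ring[OF ideal])
  assume "1 \<in> I"
  then have "f \<in> I" for f using mult_mem[of 1 f] by simp
  then have zero: "residue = (\<lambda>_. \<zero>\<^bsub>quot_alg I\<^esub>)"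
    by (intro ext) (simp only: residue_eq_zero_iff)
  have carrier: "carrier (quot_alg I) = {\<zero>\<^bsub>quot_alg I\<^esub>}"
    unfolding carrier_quot zero by auto
  have piece: "graded_piece I i = {\<zero>\<^bsub>quot_alg I\<^esub>}"
    unfolding graded_piece_def zero using forms_zero[of i] by (rule image_constant)
  have "n = 0 \<and> E = {\<zero>\<^bsub>quot_alg I\<^esub>}" if "Q.dimension n (scalars I) E" for n E
    using that by (induction rule: Q.dimension.induct) (auto simp: carrier)
  then have "Q.dim (scalars I) {\<zero>\<^bsub>quot_alg I\<^esub>} = 0"
    unfolding Q.dim_def by (intro the_equality) auto
  then show False using assms by (simp add: hilbert_fun_def piece)
qed

lemma linear_forms_gen_if_codimension_two:
  assumes "standard_graded_artinian I" "codimension I = 2"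
  obtains U V where "U \<in> forms 1" "V \<in> forms 1" "linear_forms_gen U V"
proof -
  interpret Q: ring "quot_alg I" by (rule ideal.quotient_is_ring[OF ideal])
  have proper: "1 \<notin> I" using one_notin_if_hilbert_fun_pos[of 1] assms(2) by (simp add: codimension_def)
  note field = subfield_scalars[OF proper]
  have "subalgebra (scalars I) (graded_piece I 1) (quot_alg I)"
    unfolding scalars_eq graded_piece_def
    by (rule ring_hom_ring.img_is_subalgebra[OF residue_hom _ subalgebra_forms]) simp
  then have "Q.finite_dimension (scalars I) (graded_piece I 1)"
    using assms(1) field unfolding standard_graded_artinian_def
    by (auto intro: Q.subalbegra_incl_imp_finite_dimension simp: graded_piece_def carrier_quot)
  from Q.finite_dimensionE[OF field this] have "Q.dimension 2 (scalars I) (graded_piece I 1)"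
    using assms(2) by (simp add: codimension_def hilbert_fun_def over_def)
  from Q.exists_base[OF field this] obtain Vs
    where Vs: "set Vs \<subseteq> carrier (quot_alg I)" "length Vs = 2"
      "Q.Span (scalars I) Vs = graded_piece I 1"
    by blast
  have "set Vs \<subseteq> graded_piece I 1" using Q.Span_base_incl[OF field Vs(1)] Vs(3) by simp
  moreover obtain u v where uv: "Vs = [u, v]"
    using Vs(2) by (auto simp: numeral_2_eq_2 length_Suc_conv)
  ultimately obtain U V where UV: "U \<in> forms 1" "V \<in> forms 1" "u = residue U" "v = residue V"
    by (auto simp: graded_piece_def)
  have "linear_forms_gen U V"
    unfolding linear_forms_gen_def
  proof
    fix f :: "('n, 'k) mpoly" assume "f \<in> forms 1"
    then have "residue f \<in> Q.Span (scalars I) (map (\<lambda>x. residue (if x then U else V)) [True, False])"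
      using Vs(3) by (auto simp: uv UV graded_piece_def)
    then have "f \<in> span_mod (\<lambda>x. if x then U else V) (set [True, False])"
      by (intro span_mod_if_Span[OF proper]) auto
    then show "\<exists>a b. f - (const_poly a * U + const_poly b * V) \<in> I"
      by (auto simp: span_mod_def lincomb_def)
  qed
  then show ?thesis using UV that by blast
qed

text \<open>
  Steinitz exchange: if \<open>L\<close> is congruent to \<open>a * U + b * V\<close>, then \<open>a \<noteq> 0\<close> or \<open>b \<noteq> 0\<close>, and \<open>L\<close> can replace
  \<open>U\<close> or \<open>V\<close> accordingly.
\<close>

lemma linear_forms_gen_exchange:
  assumes gen: "linear_forms_gen U V" and U: "U \<in> forms 1" and V: "V \<in> forms 1"
    and L: "L \<in> forms 1" "L \<notin> I"
  obtains M where "M \<in> forms 1" "linear_forms_gen L M"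
proof -
  have *: "linear_forms_gen L V"
    if gen: "linear_forms_gen U V" and "a \<noteq> 0" and L: "L - (const_poly a * U + const_poly b * V) \<in> I"
    for U V a b
    unfolding linear_forms_gen_def
  proof
    fix f :: "('n, 'k) mpoly" assume "f \<in> forms 1"
    then obtain c d where f: "f - (const_poly c * U + const_poly d * V) \<in> I"
      using gen by (auto simp: linear_forms_gen_def)
    define r where "r = c / a"
    have "f - (const_poly c * U + const_poly d * V)
        - const_poly r * (L - (const_poly a * U + const_poly b * V)) \<in> I"
      by (intro diff_mem mult_mem f L)
    moreover have "const_poly c = const_poly r * (const_poly a :: ('n, 'k) mpoly)"
      using \<open>a \<noteq> 0\<close> by (simp add: r_def flip: const_poly_mult)
    ultimately have "f - (const_poly r * L + const_poly (d - r * b) * V) \<in> I"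
      by (simp add: const_poly_diff const_poly_mult algebra_simps)
    then show "\<exists>a b. f - (const_poly a * L + const_poly b * V) \<in> I" by blast
  qed
  obtain a b where ab: "L - (const_poly a * U + const_poly b * V) \<in> I"
    using gen L(1) by (auto simp: linear_forms_gen_def)
  have swap: "linear_forms_gen V U"
    using gen unfolding linear_forms_gen_def by (metis add.commute)
  show ?thesis
  proof (cases "a = 0")
    case False
    then show ?thesis using that[OF V] *[OF gen False ab] by blast
  next
    case True
    then have "b \<noteq> 0" using ab L(2) by auto
    then show ?thesis using that[OF U] *[OF swap _ ab[unfolded add.commute[of "const_poly a * U"]]] by blast
  qed
qed

end

section \<open>The degree type determined by the partition\<close>

context homogeneous_poly_ideal begin

definition string_degree :: "(nat \<Rightarrow> nat) \<Rightarrow> nat \<times> nat \<Rightarrow> nat" where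
  "string_degree e x = e (fst x) + snd x"

lemma homogeneous_basis_strings:
  assumes basis: "string_basis L t z p" and L: "L \<in> forms 1"
    and z: "\<And>k. k < t \<Longrightarrow> z k \<in> forms (e k)"
  shows "homogeneous_basis (\<lambda>(k, j). L ^ j * z k) (SIGMA k:{..<t}. {..<p k}) (string_degree e)"
  using string_basisD(3,4)[OF basis]
  by (auto simp: homogeneous_basis_def string_degree_def add.commute[of "e k" for k]
      intro!: forms_mult forms_power L z)

lemma lengths_one_if_multiplier_mem:
  assumes basis: "string_basis L t z p" and "L \<in> I" "k < t"
  shows "p k = 1"
proof (rule ccontr)
  assume "p k \<noteq> 1"
  then have "(k, 1) \<in> (SIGMA k:{..<t}. {..<p k})"
    using string_basisD(1)[OF basis \<open>k < t\<close>] \<open>k < t\<close> by auto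
  then have "(\<lambda>(k, j). L ^ j * z k) (k, 1) \<notin> span_mod (\<lambda>(k, j). L ^ j * z k) {}"
    using string_basisD(3)[OF basis] by (intro indep_mod_not_in_span) auto
  moreover have "L * z k \<in> I" using mult_mem[OF \<open>L \<in> I\<close>, of "z k"] by (simp add: mult.commute)
  ultimately show False using span_mod_ideal by auto
qed

end

lemma homogeneous_poly_ideal_if_artinian:
  "standard_graded_artinian I \<Longrightarrow> homogeneous_poly_ideal I"
  by (auto simp: standard_graded_artinian_def homogeneous_ideal_def homogeneous_poly_ideal_def
      poly_ideal_def homogeneous_poly_ideal_axioms_def)

text \<open>
  The partition \<open>P\<close> and the degree type \<open>T\<close> come from possibly different decompositions; by the
  uniqueness of the lengths both can be read off the homogeneous one.
\<close>

lemma jordan_degree_type_strings: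
  assumes "standard_graded_artinian I" "codimension I = 2"
    and l: "l \<in> graded_piece I 1"
    and P: "is_jordan_type I l P" and T: "is_jordan_degree_type I l T"
  obtains L t z p e where "L \<in> forms 1" "poly_ideal.string_basis I L t z p"
    "\<And>k. k < t \<Longrightarrow> z k \<in> forms (e k)"
    "P = image_mset p (mset_set {..<t})"
    "T = image_mset (\<lambda>k. (p k, e k)) (mset_set {..<t})"
proof -
  interpret homogeneous_poly_ideal I using assms(1) by (rule homogeneous_poly_ideal_if_artinian)
  have proper: "1 \<notin> I"
    using one_notin_if_hilbert_fun_pos[of 1] assms(2) by (simp add: codimension_def)
  obtain L where L: "L \<in> forms 1" "l = residue L" using l by (auto simp: graded_piece_def)
  obtain zps' where P': "jordan_decomposition I (residue L) zps'" "P = mset (map snd zps')"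
    using P by (auto simp: is_jordan_type_def L(2))
  have "\<forall>k<length zps'. fst (zps' ! k) \<in> carrier (quot_alg I)"
    using P'(1) by (fastforce simp: jordan_decomposition_def dest: nth_mem)
  then have "\<forall>k. \<exists>f. k < length zps' \<longrightarrow> fst (zps' ! k) = residue f" by (auto simp: carrier_quot)
  then obtain z' where "\<And>k. k < length zps' \<Longrightarrow> fst (zps' ! k) = residue (z' k)" by metis
  then have basis': "string_basis L (length zps') z' (\<lambda>k. snd (zps' ! k))"
    by (rule string_basis_if_jordan_decomposition[OF proper P'(1)])
  obtain zps es where T': "jordan_decomposition I (residue L) zps"
      "list_all2 (\<lambda>(z, p) e. z \<in> graded_piece I e) zps es" "T = mset (zip (map snd zps) es)"
    using T by (auto simp: is_jordan_degree_type_def L(2))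
  have len: "length es = length zps" using T'(2) by (simp add: list_all2_lengthD)
  have "\<forall>k. \<exists>f. k < length zps \<longrightarrow> f \<in> forms (es ! k) \<and> fst (zps ! k) = residue f"
    using list_all2_nthD[OF T'(2)] by (fastforce simp: graded_piece_def split: prod.splits)
  then obtain z where z: "\<And>k. k < length zps \<Longrightarrow> z k \<in> forms (es ! k)"
      "\<And>k. k < length zps \<Longrightarrow> fst (zps ! k) = residue (z k)"
    by metis
  have basis: "string_basis L (length zps) z (\<lambda>k. snd (zps ! k))"
    by (rule string_basis_if_jordan_decomposition[OF proper T'(1) z(2)])
  have idx: "mset xs = image_mset (\<lambda>k. xs ! k) (mset_set {..<length xs})" for xs :: "'z list"
    by (metis lessThan_atLeast0 map_nth mset_map mset_upt)
  show ?thesis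
  proof (rule that[OF L(1) basis z(1)])
    have "P = image_mset (\<lambda>k. snd (zps' ! k)) (mset_set {..<length zps'})"
      unfolding P'(2) by (subst idx) (auto intro!: image_mset_cong)
    also have "\<dots> = image_mset (\<lambda>k. snd (zps ! k)) (mset_set {..<length zps})"
      by (rule string_lengths_unique[OF basis' basis])
    finally show "P = image_mset (\<lambda>k. snd (zps ! k)) (mset_set {..<length zps})" .
    show "T = image_mset (\<lambda>k. (snd (zps ! k), es ! k)) (mset_set {..<length zps})"
      unfolding T'(3) by (subst idx) (auto simp: len intro!: image_mset_cong)
  qed
qed

text \<open>
  A part other than \<open>1\<close> means that \<open>l\<close> is not zero, so that \<open>l\<close> belongs to a pair of generators of the
  quotient and the staircase description applies.
\<close>

lemma jordan_degree_type_count_if_nonunit_part: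
  assumes "standard_graded_artinian I" "codimension I = 2"
    and "l \<in> graded_piece I 1"
    and "is_jordan_type I l P" and "is_jordan_degree_type I l T"
    and long: "r \<in># P" "r \<noteq> 1"
  defines "n \<equiv> \<lambda>q. size {#r \<in># P. q \<le> r#}"
  shows "count T (q, i) = (if i < n q \<and> \<not> i < n (Suc q) then 1 else 0)"
proof -
  interpret homogeneous_poly_ideal I using assms(1) by (rule homogeneous_poly_ideal_if_artinian)
  obtain L t z p e where L: "L \<in> forms 1" and basis: "string_basis L t z p"
    and z: "\<And>k. k < t \<Longrightarrow> z k \<in> forms (e k)"
    and P: "P = image_mset p (mset_set {..<t})"
    and T: "T = image_mset (\<lambda>k. (p k, e k)) (mset_set {..<t})"
    by (rule jordan_degree_type_strings[OF assms(1-5)]) blast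
  have "L \<notin> I" using lengths_one_if_multiplier_mem[OF basis] long by (auto simp: P)
  moreover obtain U V where "U \<in> forms 1" "V \<in> forms 1" "linear_forms_gen U V"
    using linear_forms_gen_if_codimension_two[OF assms(1,2)] by blast
  ultimately obtain M where M: "M \<in> forms 1" "linear_forms_gen L M"
    using linear_forms_gen_exchange L by blast
  show ?thesis
    unfolding T n_def P by (rule string_degree_count[OF basis M(2) L M(1) z])
qed

text \<open>
  When all strings have length one their generators form a homogeneous basis of the quotient, so
  \<open>count T (1, i)\<close> is the Hilbert function at \<open>i\<close>.
\<close>

lemma jordan_degree_type_count_if_unit_parts:
  assumes "standard_graded_artinian I" "gorenstein I" "codimension I = 2"
    and d: "socle_degree I = d"
    and "l \<in> graded_piece I 1"
    and "is_jordan_type I l P" and "is_jordan_degree_type I l T"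
    and short: "\<And>r. r \<in># P \<Longrightarrow> r = 1"
  defines "h \<equiv> \<lambda>i. count T (1, i)"
  shows "h i \<le> Suc i" "h i \<le> i \<Longrightarrow> h (Suc i) \<le> h i"
    "i \<le> d \<Longrightarrow> h i = h (d - i)" "d < i \<Longrightarrow> h i = 0"
    "(\<Sum>i\<le>d. h i) = size P" "q \<noteq> 1 \<Longrightarrow> count T (q, i) = 0"
proof -
  interpret homogeneous_poly_ideal I using assms(1) by (rule homogeneous_poly_ideal_if_artinian)
  obtain L t z p e where L: "L \<in> forms 1" and basis: "string_basis L t z p"
    and z: "\<And>k. k < t \<Longrightarrow> z k \<in> forms (e k)"
    and P: "P = image_mset p (mset_set {..<t})"
    and T: "T = image_mset (\<lambda>k. (p k, e k)) (mset_set {..<t})"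
    by (rule jordan_degree_type_strings[OF assms(1,3,5-7)]) blast
  obtain U V where U: "U \<in> forms 1" and V: "V \<in> forms 1" and gen: "linear_forms_gen U V"
    using linear_forms_gen_if_codimension_two[OF assms(1,3)] by blast
  obtain F where F: "F \<in> forms d" "I = annihilator F"
    using assms(2) d by (auto simp: gorenstein_def)
  have p: "p k = 1" if "k < t" for k using short that by (auto simp: P)
  define X where "X = (SIGMA k:{..<t}. {..<p k})"
  have count: "count T (q, i) = card {k \<in> {..<t}. p k = q \<and> e k = i}" for q i
    unfolding T by (simp add: count_image_mset Int_def vimage_def conj_commute)
  have hb: "homogeneous_basis (\<lambda>(k, j). L ^ j * z k) X (string_degree e)"
    unfolding X_def by (rule homogeneous_basis_strings[OF basis L z])
  have h_eq: "h i = card {x \<in> X. string_degree e x = i}" for i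
  proof -
    have "{x \<in> X. string_degree e x = i} = (\<lambda>k. (k, 0)) ` {k \<in> {..<t}. p k = 1 \<and> e k = i}"
      using p by (auto simp: X_def string_degree_def)
    moreover have "card ((\<lambda>k. (k, 0 :: nat)) ` A) = card A" for A :: "nat set"
      by (intro card_image inj_onI) simp
    ultimately show ?thesis by (simp only: h_def count)
  qed
  have zero: "h i = 0" if "d < i" for i
    unfolding h_eq by (rule hilbert_zero_above_socle_degree[OF F hb that])
  show "h i \<le> Suc i" unfolding h_eq by (rule hilbert_le_Suc[OF hb gen])
  show "h (Suc i) \<le> h i" if "h i \<le> i"
    using that unfolding h_eq by (rule hilbert_nonincreasing[OF hb gen U V])
  show "h i = h (d - i)" if "i \<le> d"
    unfolding h_eq by (rule hilbert_symmetric[OF F hb that])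
  show "h i = 0" if "d < i" by (rule zero[OF that])
  have "{k \<in> {..<t}. p k = q \<and> e k = i} = {}" if "q \<noteq> 1" using p that by auto
  then show "count T (q, i) = 0" if "q \<noteq> 1" using that by (simp only: count card.empty not_False_eq_True)
  have h_card: "h i = card {k \<in> {..<t}. e k = i}" for i
    unfolding h_def count using p by (intro arg_cong[of _ _ card]) auto
  have "e k \<le> d" if "k < t" for k
  proof (rule ccontr)
    assume "\<not> e k \<le> d"
    then have "card {k' \<in> {..<t}. e k' = e k} = 0" using zero[of "e k"] h_card by simp
    then show False using that by (auto simp: card_eq_0_iff)
  qed
  then have "(\<Sum>i\<le>d. \<Sum>k\<in>{k \<in> {..<t}. e k = i}. 1) = (\<Sum>k<t. 1 :: nat)"
    by (intro sum.group) auto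
  then show "(\<Sum>i\<le>d. h i) = size P" by (simp add: h_card P)
qed

theorem theorem3p1:
  fixes I :: "('n::finite, 'k::field_char_0) mpoly set"
    and J :: "('m::finite, 'k) mpoly set"
    and d :: nat
  assumes "standard_graded_artinian I" and "gorenstein I"
    and "codimension I = 2" and "socle_degree I = d"
    and "standard_graded_artinian J" and "gorenstein J"
    and "codimension J = 2" and "socle_degree J = d"
    and "l \<in> graded_piece I 1" and "l' \<in> graded_piece J 1"
    and "is_jordan_type I l P" and "is_jordan_type J l' P"
    and "is_jordan_degree_type I l T" and "is_jordan_degree_type J l' T'"
  shows "T = T'"
proof (cases "\<exists>r. r \<in># P \<and> r \<noteq> 1")
  case True
  then obtain r where "r \<in># P" "r \<noteq> 1" by blast
  then have "count T (q, i) = count T' (q, i)" for q i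
    using jordan_degree_type_count_if_nonunit_part[OF assms(1,3,9,11,13), of r q i]
      jordan_degree_type_count_if_nonunit_part[OF assms(5,7,10,12,14), of r q i]
    by simp
  then show ?thesis by (intro multiset_eqI) auto
next
  case False
  then have short: "\<And>r. r \<in># P \<Longrightarrow> r = 1" by blast
  note I_facts = jordan_degree_type_count_if_unit_parts[OF assms(1-4,9,11,13) short]
  note J_facts = jordan_degree_type_count_if_unit_parts[OF assms(5-8,10,12,14) short]
  have "(\<Sum>i\<le>d. count T (1, i)) = (\<Sum>i\<le>d. count T' (1, i))"
    using I_facts(5) J_facts(5) by simp
  then have "(\<lambda>i. count T (1, i)) = (\<lambda>i. count T' (1, i))"
    by (intro symmetric_unimodal_eq_if_sum_eq[of _ d] I_facts(1-4) J_facts(1-4))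
  then have one: "count T (1, i) = count T' (1, i)" for i by (rule fun_cong)
  have "count T (q, i) = count T' (q, i)" for q i
    using one[of i] I_facts(6)[of q i] J_facts(6)[of q i] by (cases "q = 1") simp_all
  then show ?thesis by (intro multiset_eqI) auto
qed

end
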